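(* Let $\mathbf x_1,\dots,\mathbf x_n$ be independent draws from a probability distribution $P$ on $\mathbb R^d$, let $K\ge 2$ be a fixed integer, $R>0$, and suppose $P$ satisfies the density and optimal-centre regularity assumption stated in the context, with constants $\underline f_R,\overline f$. Let $\epsilon_0,a_0,\theta_0,\tau_R,\zeta_{n,R}(\epsilon_0),\eta_r,\Psi_n,V_{d,K}$ be as defined in the context. Let $n\ge V_{d,K}$, $0<r\le 4(2R+a_0)$ and $0<\delta_{\mathrm g}<1$. Put $\overline\mu_n(r)=(n-1)\overline f v_d r^d$ and $$q_n(r,\delta_{\mathrm g})=\min\Big\{n-1,\ \Big\lceil\overline\mu_n(r)+\sqrt{2\overline\mu_n(r)\log(n/\delta_{\mathrm g})}+\tfrac23\log(n/\delta_{\mathrm g})\Big\rceil\Big\}.$$ Then for every integer $q\ge q_n(r,\delta_{\mathrm g})$ and every scaffold $H_q$ (a simple undirected graph on $[n]$, possibly depending on the data) with $H_q\supseteq Q_q(\mathbf X)$, $$\mathbb P\{\mathrm{OPT}(H_q,K)>\mathrm{OPT}_{\mathrm{unc}}(K)\}\le\zeta_{n,R}(\epsilon_0)+n\tau_R+\Psi_n(\eta_r,V_{d,K})+\delta_{\mathrm g}.$$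
   Context: **Clustering notation.** For nonempty $A\subseteq[n]$, $\phi_{\mathrm{SSE}}(A)=\sum_{i\in A}\|\mathbf x_i-\boldsymbol\mu(A)\|^2$ with $\boldsymbol\mu(A)=|A|^{-1}\sum_{i\in A}\mathbf x_i$. $\mathrm{OPT}_{\mathrm{unc}}(K)$ is the minimum of $\sum_{A\in\ell}\phi_{\mathrm{SSE}}(A)$ over partitions $\ell$ of $[n]$ into exactly $K$ nonempty blocks; $\mathrm{OPT}(H,K)$ is the same minimum restricted to partitions each of whose blocks induces a connected subgraph of $H$ ($\min\emptyset=+\infty$). **Nearest-neighbour graph.** $Q_q(\mathbf X)$ is the undirected union $q$-nearest-neighbour graph on $[n]$ including whole tied shells: for $i\ne j$, $\{i,j\}$ is an edge iff $\min\{\rho_i(j),\rho_j(i)\}\le q$, where $\rho_i(j)=1+\#\{s\notin\{i,j\}:\|\mathbf x_i-\mathbf x_s\|<\|\mathbf x_i-\mathbf x_j\|\}$. ($Q_0$ is empty, $Q_q$ is complete for $q\ge n-1$.) **Risks.** $B(\mathbf z,s)$ is the closed Euclidean ball, $v_d$ the volume of the unit ball in $\mathbb R^d$. For $\mathbf c=(\mathbf c_1,\dots,\mathbf c_K)\in(\mathbb R^d)^K$: $\mathcal Q_P(\mathbf c)=\mathbb E_P\min_k\|\mathbf x-\mathbf c_k\|^2$, $\mathcal Q_n(\mathbf c)=n^{-1}\sum_i\min_k\|\mathbf x_i-\mathbf c_k\|^2$. $\mathcal C_R=B(\mathbf 0,R)^K$, $\mathcal Q_P^\star=\inf_{\mathbf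 c\in(\mathbb R^d)^K}\mathcal Q_P(\mathbf c)$, $\mathfrak C_{P,R}=\{\mathbf c\in\mathcal C_R:\mathcal Q_P(\mathbf c)=\mathcal Q_P^\star\}$, $\tau_R=P\{\|\mathbf x\|>R\}$. **Assumption (density and optimal-centre regularity).** $P$ has finite second moment and a Lebesgue density $f$ with $0<\underline f_R\le f(\mathbf x)$ for $\|\mathbf x\|\le R$ and $f(\mathbf x)\le\overline f<\infty$ for all $\mathbf x\in\mathbb R^d$. The set $\mathfrak C_{P,R}$ is nonempty, and every member has pairwise distinct centres, all strictly inside the ball ($\|\mathbf c_k\|<R$). Uniqueness is not required. **Localization constants.** $d_\infty(\mathbf c,\mathbf c')=\max_k\|\mathbf c_k-\mathbf c'_k\|$; $d_{P,R}(\mathbf c)=\min_{\mathbf c'\in\mathfrak C_{P,R}}d_\infty(\mathbf c,\mathbf c')$. For $\epsilon>0$, $g_{P,R}(\epsilon)=\inf\{\mathcal Q_P(\mathbf c)-\mathcal Q_P^\star:\mathbf c\in\mathcal C_R,\ d_{P,R}(\mathbf c)\ge\epsilon\}$ ($+\infty$ if the set is empty). $Z_{n,R}=\sup_{\mathbf c\in\mathcal C_R}|\mathcal Q_n(\mathbf c)-\mathcal Q_P(\mathbf c)|$. $\zeta_{n,R}(\epsilon)=\mathbb P\{2Z_{n,R}\ge g_{P,R}(\epsilon)\}$. $\Delta_*=\min_{\mathbf c\in\mathfrak C_{P,R}}\min_{k\ne l}\|\mathbf c_k-\mathbf c_l\|>0$ and $\rho_*=\min_{\mathbf c\in\mathfrak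 C_{P,R}}\min_k(R-\|\mathbf c_k\|)>0$. Fix any $0<\epsilon_0<\min\{\Delta_*/4,\rho_*/2\}$ and put $a_0=\min\{(\Delta_*-2\epsilon_0)/2,\ \rho_*-\epsilon_0\}>0$, $\theta_0=\big(a_0/(2R+a_0)\big)^d$. **Other constants.** $\eta_r=\underline f_R\theta_0v_d(r/4)^d$; $V_{d,K}=\lceil2K(d+1)\log_2(2eK)\rceil$; for $n\ge v$, $\Psi_n(\eta,v)=\min\{1,\ 2(2en/v)^ve^{-n\eta/4}\}$. *)

theory Defs
  imports "HOL-Probability.Probability"
begin

text \<open>
  The space \<open>\<real>\<^sup>d\<close> is a type of class \<^class>\<open>euclidean_space\<close>, with \<open>d = DIM('a)\<close>;
  \<open>[n]\<close> is \<open>{1..n}\<close>, and a point configuration is a function \<open>x :: nat \<Rightarrow> 'a\<close> of which only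
  the values on \<open>{1..n}\<close> matter.  The volume of the unit ball is \<^const>\<open>unit_ball_vol\<close>
  (see \<open>content_cball\<close>).
\<close>

definition mean_point :: "(nat \<Rightarrow> 'a::euclidean_space) \<Rightarrow> nat set \<Rightarrow> 'a" where
  "mean_point x A = (1 / real (card A)) *\<^sub>R (\<Sum>i\<in>A. x i)"

definition phi_SSE :: "(nat \<Rightarrow> 'a::euclidean_space) \<Rightarrow> nat set \<Rightarrow> real" where
  "phi_SSE x A = (\<Sum>i\<in>A. (norm (x i - mean_point x A))\<^sup>2)"

text \<open>
  The infima in \<open>OPT_unc\<close> and \<open>OPT\<close> range over finite sets, so they are minima when the set is nonempty;
  an infimum in \<^typ>\<open>ereal\<close> over the empty set is \<open>\<infinity>\<close>.
\<close>

definition OPT_unc :: "nat \<Rightarrow> (nat \<Rightarrow> 'a::euclidean_space) \<Rightarrow> nat \<Rightarrow> ereal" where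
  "OPT_unc n x K =
     (INF l\<in>{l. partition_on {1..n} l \<and> card l = K}. ereal (\<Sum>A\<in>l. phi_SSE x A))"

text \<open>A graph on \<open>[n]\<close> is given by its set of edges, an edge being a two-element set.\<close>

definition simple_graph :: "nat \<Rightarrow> nat set set \<Rightarrow> bool" where
  "simple_graph n E \<longleftrightarrow> E \<subseteq> {{i, j} | i j. i \<in> {1..n} \<and> j \<in> {1..n} \<and> i \<noteq> j}"

definition induces_connected :: "nat set set \<Rightarrow> nat set \<Rightarrow> bool" where
  "induces_connected E A \<longleftrightarrow>
     (\<forall>i\<in>A. \<forall>j\<in>A. (i, j) \<in> {(u, v). u \<in> A \<and> v \<in> A \<and> {u, v} \<in> E}\<^sup>*)"

definition OPT :: "nat \<Rightarrow> (nat \<Rightarrow> 'a::euclidean_space) \<Rightarrow> nat set set \<Rightarrow> nat \<Rightarrow> ereal" where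
  "OPT n x E K =
     (INF l\<in>{l. partition_on {1..n} l \<and> card l = K \<and> (\<forall>A\<in>l. induces_connected E A)}.
        ereal (\<Sum>A\<in>l. phi_SSE x A))"

definition nn_rank :: "nat \<Rightarrow> (nat \<Rightarrow> 'a::euclidean_space) \<Rightarrow> nat \<Rightarrow> nat \<Rightarrow> nat" where
  "nn_rank n x i j =
     1 + card {s \<in> {1..n}. s \<notin> {i, j} \<and> norm (x i - x s) < norm (x i - x j)}"

definition nn_graph :: "nat \<Rightarrow> (nat \<Rightarrow> 'a::euclidean_space) \<Rightarrow> nat \<Rightarrow> nat set set" where
  "nn_graph n x q =
     {{i, j} | i j. i \<in> {1..n} \<and> j \<in> {1..n} \<and> i \<noteq> j \<and>
                    min (nn_rank n x i j) (nn_rank n x j i) \<le> q}"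

text \<open>
  A \<open>K\<close>-tuple of centres is an extensional function on \<open>{1..K}\<close>.
\<close>

definition dist_to_centres :: "nat \<Rightarrow> (nat \<Rightarrow> 'a::euclidean_space) \<Rightarrow> 'a \<Rightarrow> real" where
  "dist_to_centres K c x = (MIN k\<in>{1..K}. (norm (x - c k))\<^sup>2)"

definition pop_risk :: "'a::euclidean_space measure \<Rightarrow> nat \<Rightarrow> (nat \<Rightarrow> 'a) \<Rightarrow> real" where
  "pop_risk P K c = (\<integral>x. dist_to_centres K c x \<partial>P)"

definition emp_risk ::
    "nat \<Rightarrow> (nat \<Rightarrow> 'a::euclidean_space) \<Rightarrow> nat \<Rightarrow> (nat \<Rightarrow> 'a) \<Rightarrow> real" where
  "emp_risk n x K c = (1 / real n) * (\<Sum>i=1..n. dist_to_centres K c (x i))"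

definition centre_set :: "nat \<Rightarrow> real \<Rightarrow> (nat \<Rightarrow> 'a::euclidean_space) set" where
  "centre_set K R = {1..K} \<rightarrow>\<^sub>E cball 0 R"

definition opt_risk :: "'a::euclidean_space measure \<Rightarrow> nat \<Rightarrow> real" where
  "opt_risk P K = (INF c\<in>{1..K} \<rightarrow>\<^sub>E UNIV. pop_risk P K c)"

definition opt_centres ::
    "'a::euclidean_space measure \<Rightarrow> nat \<Rightarrow> real \<Rightarrow> (nat \<Rightarrow> 'a) set" where
  "opt_centres P K R = {c \<in> centre_set K R. pop_risk P K c = opt_risk P K}"

definition tail_mass :: "'a::euclidean_space measure \<Rightarrow> real \<Rightarrow> real" where
  "tail_mass P R = measure P {x. norm x > R}"

definition regular_density ::
    "'a::euclidean_space measure \<Rightarrow> nat \<Rightarrow> real \<Rightarrow> ('a \<Rightarrow> real) \<Rightarrow> real \<Rightarrow> real \<Rightarrow> bool" where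
  "regular_density P K R f flo fhi \<longleftrightarrow>
     integrable P (\<lambda>x. (norm x)\<^sup>2) \<and>
     f \<in> borel_measurable borel \<and> (\<forall>x. 0 \<le> f x) \<and>
     P = density lborel (\<lambda>x. ennreal (f x)) \<and>
     0 < flo \<and> (\<forall>x. norm x \<le> R \<longrightarrow> flo \<le> f x) \<and> (\<forall>x. f x \<le> fhi) \<and>
     opt_centres P K R \<noteq> {} \<and>
     (\<forall>c\<in>opt_centres P K R. inj_on c {1..K} \<and> (\<forall>k\<in>{1..K}. norm (c k) < R))"

text \<open>
  Under the regularity assumption the set of optimal centres is nonempty and compact, so the
  real infima over it (in \<open>dist_to_opt\<close>, \<open>centre_sep\<close> and \<open>centre_margin\<close>) are attained.
\<close>

definition d_inf :: "nat \<Rightarrow> (nat \<Rightarrow> 'a::euclidean_space) \<Rightarrow> (nat \<Rightarrow> 'a) \<Rightarrow> real" where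
  "d_inf K c c' = (MAX k\<in>{1..K}. norm (c k - c' k))"

definition dist_to_opt ::
    "'a::euclidean_space measure \<Rightarrow> nat \<Rightarrow> real \<Rightarrow> (nat \<Rightarrow> 'a) \<Rightarrow> real" where
  "dist_to_opt P K R c = (INF c'\<in>opt_centres P K R. d_inf K c c')"

definition risk_gap :: "'a::euclidean_space measure \<Rightarrow> nat \<Rightarrow> real \<Rightarrow> real \<Rightarrow> ereal" where
  "risk_gap P K R \<epsilon> =
     (INF c\<in>{c \<in> centre_set K R. \<epsilon> \<le> dist_to_opt P K R c}.
        ereal (pop_risk P K c - opt_risk P K))"

text \<open>
  For \<open>P\<close> with finite second moment the supremum is over a bounded set of reals.
\<close>

definition unif_dev ::
    "nat \<Rightarrow> (nat \<Rightarrow> 'a) \<Rightarrow> 'a::euclidean_space measure \<Rightarrow> nat \<Rightarrow> real \<Rightarrow> real" where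
  "unif_dev n x P K R = (SUP c\<in>centre_set K R. \<bar>emp_risk n x K c - pop_risk P K c\<bar>)"

definition zeta ::
    "'w measure \<Rightarrow> nat \<Rightarrow> (nat \<Rightarrow> 'w \<Rightarrow> 'a) \<Rightarrow> 'a::euclidean_space measure
       \<Rightarrow> nat \<Rightarrow> real \<Rightarrow> real \<Rightarrow> real" where
  "zeta M n X P K R \<epsilon> =
     measure M {\<omega> \<in> space M.
       risk_gap P K R \<epsilon> \<le> ereal (2 * unif_dev n (\<lambda>i. X i \<omega>) P K R)}"

definition centre_sep :: "'a::euclidean_space measure \<Rightarrow> nat \<Rightarrow> real \<Rightarrow> real" where
  "centre_sep P K R =
     Inf {norm (c k - c l) | c k l.
            c \<in> opt_centres P K R \<and> k \<in> {1..K} \<and> l \<in> {1..K} \<and> k \<noteq> l}"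

definition centre_margin :: "'a::euclidean_space measure \<Rightarrow> nat \<Rightarrow> real \<Rightarrow> real" where
  "centre_margin P K R =
     Inf {R - norm (c k) | c k. c \<in> opt_centres P K R \<and> k \<in> {1..K}}"

definition a_zero :: "'a::euclidean_space measure \<Rightarrow> nat \<Rightarrow> real \<Rightarrow> real \<Rightarrow> real" where
  "a_zero P K R \<epsilon>\<^sub>0 =
     min ((centre_sep P K R - 2 * \<epsilon>\<^sub>0) / 2) (centre_margin P K R - \<epsilon>\<^sub>0)"

definition theta_zero :: "'a::euclidean_space measure \<Rightarrow> nat \<Rightarrow> real \<Rightarrow> real \<Rightarrow> real" where
  "theta_zero P K R \<epsilon>\<^sub>0 =
     (a_zero P K R \<epsilon>\<^sub>0 / (2 * R + a_zero P K R \<epsilon>\<^sub>0)) ^ DIM('a)"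

definition eta ::
    "'a::euclidean_space measure \<Rightarrow> nat \<Rightarrow> real \<Rightarrow> real \<Rightarrow> real \<Rightarrow> real \<Rightarrow> real" where
  "eta P K R \<epsilon>\<^sub>0 flo r =
     flo * theta_zero P K R \<epsilon>\<^sub>0 * unit_ball_vol (real DIM('a)) * (r / 4) ^ DIM('a)"

definition V_const :: "nat \<Rightarrow> nat \<Rightarrow> nat" where
  "V_const d K = nat \<lceil>2 * real K * (real d + 1) * log 2 (2 * exp 1 * real K)\<rceil>"

definition Psi :: "nat \<Rightarrow> real \<Rightarrow> nat \<Rightarrow> real" where
  "Psi n \<eta> v =
     min 1 (2 * (2 * exp 1 * real n / real v) ^ v * exp (- (real n * \<eta> / 4)))"

definition mu_bar :: "nat \<Rightarrow> nat \<Rightarrow> real \<Rightarrow> real \<Rightarrow> real" where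
  "mu_bar d n fhi r = (real n - 1) * fhi * unit_ball_vol (real d) * r ^ d"

text \<open>When \<open>n \<ge> 1\<close>, \<open>fhi, r \<ge> 0\<close> and \<open>0 < \<delta> \<le> 1\<close>, the argument of the ceiling is nonnegative, so \<^const>\<open>nat\<close> does not truncate.\<close>

definition q_threshold :: "nat \<Rightarrow> nat \<Rightarrow> real \<Rightarrow> real \<Rightarrow> real \<Rightarrow> nat" where
  "q_threshold d n fhi r \<delta> =
     min (n - 1)
       (nat \<lceil>mu_bar d n fhi r + sqrt (2 * mu_bar d n fhi r * ln (real n / \<delta>))
              + 2 / 3 * ln (real n / \<delta>)\<rceil>)"

end

theory Submission
  imports Defs
begin

text \<open>
  An optimal partition into \<open>K\<close> blocks consists of the Voronoi cells of its block means.  Off the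
  event behind \<open>zeta\<close> these means are close to an optimal tuple of centres, so each cell contains
  a ball of radius \<open>a_zero\<close> around its centre.  Shrinking this ball towards a point \<open>z\<close> of the
  cell shows that within distance \<open>r / 4\<close> of \<open>z\<close> the cell contains a ball of a
  radius \<open>s\<close> that depends only on \<open>r\<close>, and the lower density bound gives it mass at least
  \<open>eta\<close>.  If every such ball contains a sample point, one can walk along the segment between two
  points of a block through sample points of the block, in steps of length at most \<open>r\<close>.  By a
  Bernstein bound no ball of radius \<open>r\<close> around a sample point contains more than \<open>q\<close> others, so
  all these steps are edges of the nearest-neighbour graph.

  Since the balls to be hit have a fixed radius, a finite net of their centres replaces the
  Vapnik--Chervonenkis argument that the form of \<open>Psi\<close> suggests.
\<close>

section \<open>Optimal partitions\<close>

text \<open>The deviations from the mean sum to zero, so expanding around the mean leaves no cross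
  term: the cost of another centre \<open>y\<close> is larger by \<open>card A\<close> times the
  squared distance of \<open>y\<close> from the mean.\<close>

lemma phi_SSE_le:
  fixes x :: "nat \<Rightarrow> 'a::euclidean_space"
  assumes "finite A"
  shows "phi_SSE x A \<le> (\<Sum>i\<in>A. (norm (x i - y))\<^sup>2)"
proof (cases "A = {}")
  case False
  define m where "m = mean_point x A"
  have c: "real (card A) \<noteq> 0" using False assms by simp
  have "(\<Sum>i\<in>A. x i - m) = 0"
    using c by (simp add: m_def mean_point_def sum_subtractf scaleR_conv_of_real[symmetric] sum_constant_scaleR)
  then have z: "(\<Sum>i\<in>A. (x i - m) \<bullet> (m - y)) = 0"
    by (metis inner_sum_left inner_zero_left)
  have "(norm (x i - y))\<^sup>2 = (norm (x i - m))\<^sup>2 + 2 * ((x i - m) \<bullet> (m - y)) + (norm (m - y))\<^sup>2" for i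
    by (simp add: power2_norm_eq_inner inner_diff inner_commute algebra_simps)
  then have "(\<Sum>i\<in>A. (norm (x i - y))\<^sup>2) = phi_SSE x A + card A * (norm (m - y))\<^sup>2"
    using z by (simp add: sum.distrib phi_SSE_def m_def flip: sum_distrib_left)
  then show ?thesis by simp
qed (simp add: phi_SSE_def)

text \<open>Common surgery behind the two exchange arguments below, splitting a block and moving a
  point. The second claim lets cardinalities and costs of the kept and the new blocks be
  added.\<close>

lemma partition_on_replace:
  assumes l: "partition_on S l" and C: "C \<subseteq> l" and C': "partition_on (\<Union>C) C'"
  shows "partition_on S ((l - C) \<union> C')" "(l - C) \<inter> C' = {}"
proof -
  have dj: "disjnt A B" if "A \<in> l - C" "B \<in> C'" for A B
  proof -
    have "disjnt A D" if "D \<in> C" for D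
      using that \<open>A \<in> l - C\<close> C by (intro pairwiseD[OF partition_onD2[OF l]]) auto
    then have "disjnt A (\<Union>C)" by (auto simp: disjnt_def)
    then show ?thesis using \<open>B \<in> C'\<close> partition_onD1[OF C'] by (auto simp: disjnt_def)
  qed
  show "partition_on S ((l - C) \<union> C')"
  proof (rule partition_onI)
    show "\<Union>((l - C) \<union> C') = S"
      using partition_onD1[OF l] partition_onD1[OF C'] C by auto
    show "disjnt p q" if "p \<in> (l - C) \<union> C'" "q \<in> (l - C) \<union> C'" "p \<noteq> q" for p q
      using that dj disjnt_sym[OF dj] partition_onD2[OF l] partition_onD2[OF C']
      by (auto simp: pairwise_def disjnt_sym)
    show "{} \<notin> (l - C) \<union> C'"
      using partition_onD3[OF l] partition_onD3[OF C'] by simp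
  qed
  have False if "A \<in> l - C" "A \<in> C'" for A
    using dj[OF that] that(2) partition_onD3[OF C'] by (auto simp: disjnt_def)
  then show "(l - C) \<inter> C' = {}" by blast
qed

text \<open>Splitting a point off a block with at least two points adds one block, and the cost
  cannot rise, as the new singleton costs nothing. Nearest-centre assignments may leave cells empty;
  this restores the exact number \<open>K\<close> of blocks.\<close>

lemma partition_on_refine_card:
  fixes x :: "nat \<Rightarrow> 'a::euclidean_space"
  assumes "partition_on S l" "finite S" "card l \<le> K" "K \<le> card S"
  shows "\<exists>l'. partition_on S l' \<and> card l' = K \<and> (\<Sum>A\<in>l'. phi_SSE x A) \<le> (\<Sum>A\<in>l. phi_SSE x A)"
  using assms
proof (induction "K - card l" arbitrary: l)
  case 0
  then have "card l = K" by simp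
  with 0 show ?case by blast
next
  case (Suc m)
  have fl: "finite l" using Suc.prems finite_elements by metis
  have fA: "finite A" if "A \<in> l" for A
    using finite_subset[OF Union_upper[OF that]] partition_onD1[OF Suc.prems(1)] Suc.prems(2) by simp
  have "\<exists>A\<in>l. card A \<noteq> 1"
  proof (rule ccontr)
    assume "\<not> (\<exists>A\<in>l. card A \<noteq> 1)"
    then have "(\<Sum>A\<in>l. card A) = card l" by simp
    moreover have "(\<Sum>A\<in>l. card A) = card S"
      using card_Union_disjoint[of l] partition_onD1[OF Suc.prems(1)] partition_onD2[OF Suc.prems(1)] fA
      by simp
    ultimately show False using Suc by simp
  qed
  then obtain A where A: "A \<in> l" "card A \<noteq> 1" by blast
  have "A \<noteq> {}" using A Suc.prems by (metis partition_onD3)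
  then obtain i where i: "i \<in> A" by blast
  have ne: "A - {i} \<noteq> {}" using A i by (metis card_1_singleton_iff insert_Diff One_nat_def)
  define C' where "C' = {{i}, A - {i}}"
  have C': "partition_on (\<Union>{A}) C'"
    using ne i by (auto simp: partition_on_def C'_def disjoint_def)
  note rep = partition_on_replace[OF Suc.prems(1) _ C']
  have C2: "card C' = 2" using ne by (auto simp: C'_def card_insert_if)
  let ?l = "(l - {A}) \<union> C'"
  have "finite C'" by (simp add: C'_def)
  then have "card ?l = card (l - {A}) + card C'"
    using rep(2) A(1) fl by (intro card_Un_disjoint) auto
  then have card: "card ?l = Suc (card l)"
    using card.remove[OF fl A(1)] C2 by simp
  have "(\<Sum>B\<in>C'. phi_SSE x B) = phi_SSE x {i} + phi_SSE x (A - {i})"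
    using ne unfolding C'_def by (subst sum.insert) auto
  also have "\<dots> \<le> (\<Sum>j\<in>A - {i}. (norm (x j - mean_point x A))\<^sup>2)"
    using phi_SSE_le[of "A - {i}" x] fA[OF A(1)] by (simp add: phi_SSE_def mean_point_def)
  also have "\<dots> \<le> phi_SSE x A"
    unfolding phi_SSE_def by (rule sum_mono2) (use fA[OF A(1)] in auto)
  finally have "(\<Sum>B\<in>C'. phi_SSE x B) \<le> phi_SSE x A" .
  moreover have "(\<Sum>B\<in>?l. phi_SSE x B) = (\<Sum>B\<in>l - {A}. phi_SSE x B) + (\<Sum>B\<in>C'. phi_SSE x B)"
    using rep(2) A(1) fl \<open>finite C'\<close> by (intro sum.union_disjoint) auto
  ultimately have "(\<Sum>B\<in>?l. phi_SSE x B) \<le> (\<Sum>B\<in>l. phi_SSE x B)"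
    using sum.remove[OF fl A(1), of "phi_SSE x"] by simp
  moreover have "\<exists>l'. partition_on S l' \<and> card l' = K \<and> (\<Sum>A\<in>l'. phi_SSE x A) \<le> (\<Sum>A\<in>?l. phi_SSE x A)"
    by (rule Suc.hyps(1)) (use Suc.hyps(2) Suc.prems card rep(1) A in auto)
  ultimately show ?case by (elim exE conjE) (rule exI, intro conjI, assumption+, rule order_trans)
qed

definition opt_partition :: "nat \<Rightarrow> (nat \<Rightarrow> 'a::euclidean_space) \<Rightarrow> nat \<Rightarrow> nat set set \<Rightarrow> bool" where
  "opt_partition n x K l \<longleftrightarrow> is_arg_min (\<lambda>l. \<Sum>A\<in>l. phi_SSE x A)
     (\<lambda>l. partition_on {1..n} l \<and> card l = K) l"

lemma opt_partition_iff:
  "opt_partition n x K l \<longleftrightarrow> partition_on {1..n} l \<and> card l = K \<and>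
     (\<forall>l'. partition_on {1..n} l' \<and> card l' = K \<longrightarrow> (\<Sum>A\<in>l. phi_SSE x A) \<le> (\<Sum>A\<in>l'. phi_SSE x A))"
  by (auto simp: opt_partition_def is_arg_min_linorder)

lemma opt_partition_exists:
  fixes x :: "nat \<Rightarrow> 'a::euclidean_space"
  assumes "1 \<le> K" "K \<le> n"
  obtains l where "opt_partition n x K l"
proof -
  let ?F = "{l. partition_on {1..n} l \<and> card l = K}"
  have "?F \<subseteq> Pow (Pow {1..n})" by (auto simp: partition_on_def)
  then have fin: "finite ?F" by (rule finite_subset) simp
  have "partition_on {1..n} {{1..n}}" using assms by (auto simp: partition_on_def)
  from partition_on_refine_card[OF this, of K]
  have "?F \<noteq> {}" using assms by auto
  from ex_is_arg_min_if_finite[OF fin this] show ?thesis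
    using that by (auto simp: opt_partition_def)
qed

text \<open>Group the points by a nearest centre. The nonempty groups form a partition with at most
  \<open>K\<close> blocks, which can be refined to exactly \<open>K\<close>; replacing the centre of
  each group by its mean only lowers the cost.\<close>

lemma opt_partition_le_centres:
  fixes x :: "nat \<Rightarrow> 'a::euclidean_space"
  assumes "opt_partition n x K l" "1 \<le> K" "K \<le> n"
  shows "(\<Sum>A\<in>l. phi_SSE x A) \<le> (\<Sum>i=1..n. dist_to_centres K c (x i))"
proof -
  have "\<exists>k. k \<in> {1..K} \<and> dist_to_centres K c y = (norm (y - c k))\<^sup>2" for y
  proof -
    have "dist_to_centres K c y \<in> (\<lambda>k. (norm (y - c k))\<^sup>2) ` {1..K}"
      unfolding dist_to_centres_def using assms by (intro Min_in) auto
    then show ?thesis by auto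
  qed
  then obtain g where g: "g y \<in> {1..K}" "dist_to_centres K c y = (norm (y - c (g y)))\<^sup>2" for y
    by metis
  define h where "h i = g (x i)" for i
  define F where "F k = {i\<in>{1..n}. h i = k}" for k
  \<comment> \<open>Only labels that occur are used, so every fibre is nonempty and its label can be
    read off from any of its points.\<close>
  have inj: "inj_on F (h ` {1..n})"
    by (rule inj_on_inverseI[where g = "\<lambda>A. h (SOME i. i \<in> A)"])
      (auto simp: F_def intro: someI2)
  have "h ` {1..n} \<subseteq> {1..K}" using g by (auto simp: h_def)
  then have "card (F ` h ` {1..n}) \<le> K"
    using card_mono[of "{1..K}" "h ` {1..n}"] card_image[OF inj] by simp
  moreover have "partition_on {1..n} (F ` h ` {1..n})"
    by (auto simp: partition_on_def F_def disjoint_def)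
  ultimately obtain l' where l': "partition_on {1..n} l'" "card l' = K"
     "(\<Sum>A\<in>l'. phi_SSE x A) \<le> (\<Sum>A\<in>F ` h ` {1..n}. phi_SSE x A)"
    using partition_on_refine_card[of "{1..n}" "F ` h ` {1..n}" K x] assms by auto
  have "(\<Sum>A\<in>l. phi_SSE x A) \<le> (\<Sum>A\<in>F ` h ` {1..n}. phi_SSE x A)"
    using assms(1) l' by (auto simp: opt_partition_iff intro: order_trans)
  also have "\<dots> = (\<Sum>k\<in>h ` {1..n}. phi_SSE x (F k))"
    by (subst sum.reindex[OF inj]) simp
  also have "\<dots> \<le> (\<Sum>k\<in>h ` {1..n}. \<Sum>i\<in>F k. (norm (x i - c k))\<^sup>2)"
    by (intro sum_mono phi_SSE_le) (simp add: F_def)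
  also have "\<dots> = (\<Sum>k\<in>h ` {1..n}. \<Sum>i\<in>F k. dist_to_centres K c (x i))"
    using g by (intro sum.cong) (auto simp: F_def h_def)
  also have "\<dots> = (\<Sum>i=1..n. dist_to_centres K c (x i))"
    unfolding F_def by (rule sum.image_gen[symmetric]) simp
  finally show ?thesis .
qed

text \<open>If \<open>i\<close> were strictly nearer to the mean of \<open>B\<close>, moving it to
  \<open>B\<close> would lower the cost even with both means kept where they are, and re-centring
  can only lower it further.\<close>

lemma opt_partition_voronoi:
  fixes x :: "nat \<Rightarrow> 'a::euclidean_space"
  assumes opt: "opt_partition n x K l" and A: "A \<in> l" and B: "B \<in> l" and i: "i \<in> A"
  shows "norm (x i - mean_point x A) \<le> norm (x i - mean_point x B)"
proof (rule ccontr)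
  assume "\<not> ?thesis"
  then have lt: "norm (x i - mean_point x B) < norm (x i - mean_point x A)" by simp
  have l: "partition_on {1..n} l" using opt by (simp add: opt_partition_iff)
  have fl: "finite l" using l finite_elements by blast
  have fin: "finite D" if "D \<in> l" for D
    using finite_subset[OF Union_upper[OF that]] by (simp flip: partition_onD1[OF l])
  have AB: "A \<noteq> B" using lt by auto
  have dj: "A \<inter> B = {}" using l A B AB by (meson partition_onD2 disjointD)
  \<comment> \<open>A singleton block has its only point as mean, which no other centre can beat.
    Hence the move does not lose a block.\<close>
  have "A \<noteq> {i}"
    using lt by (auto simp: mean_point_def)
  then have ne: "A - {i} \<noteq> {}" using i by auto
  define C' where "C' = {A - {i}, insert i B}"
  have C': "partition_on (\<Union>{A, B}) C'"
    using ne i dj by (auto simp: partition_on_def C'_def disjoint_def)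
  note rep = partition_on_replace[OF l _ C']
  let ?l = "(l - {A, B}) \<union> C'"
  have AiB: "A - {i} \<noteq> insert i B" by auto
  have "card ?l = card (l - {A, B}) + card C'"
    using rep(2) A B fl by (intro card_Un_disjoint) (auto simp: C'_def)
  moreover have "card (l - {A, B}) = card l - 2"
    using A B AB fl by (subst card_Diff_subset) auto
  moreover have "2 \<le> card l"
    using card_mono[OF fl, of "{A, B}"] A B AB by simp
  ultimately have card: "card ?l = card l"
    using AiB by (simp add: C'_def)
  have "(\<Sum>D\<in>C'. phi_SSE x D) = phi_SSE x (A - {i}) + phi_SSE x (insert i B)"
    using AiB unfolding C'_def by simp
  also have "\<dots> \<le> (\<Sum>j\<in>A - {i}. (norm (x j - mean_point x A))\<^sup>2)
                 + (\<Sum>j\<in>insert i B. (norm (x j - mean_point x B))\<^sup>2)"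
    using fin[OF A] fin[OF B] by (intro add_mono phi_SSE_le) auto
  also have "\<dots> = (\<Sum>j\<in>A - {i}. (norm (x j - mean_point x A))\<^sup>2)
                 + (norm (x i - mean_point x B))\<^sup>2 + phi_SSE x B"
    using fin[OF B] dj i by (subst sum.insert) (auto simp: phi_SSE_def)
  also have "\<dots> < (\<Sum>j\<in>A - {i}. (norm (x j - mean_point x A))\<^sup>2)
                 + (norm (x i - mean_point x A))\<^sup>2 + phi_SSE x B"
    using lt by (simp add: power_strict_mono)
  also have "\<dots> = phi_SSE x A + phi_SSE x B"
    using i fin[OF A] by (simp add: phi_SSE_def sum.remove)
  finally have lt': "(\<Sum>D\<in>C'. phi_SSE x D) < (\<Sum>D\<in>{A, B}. phi_SSE x D)"
    using AB by simp
  have "(\<Sum>D\<in>?l. phi_SSE x D) = (\<Sum>D\<in>l - {A, B}. phi_SSE x D) + (\<Sum>D\<in>C'. phi_SSE x D)"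
    using rep(2) A B fl by (intro sum.union_disjoint) (auto simp: C'_def)
  also have "\<dots> < (\<Sum>D\<in>l - {A, B}. phi_SSE x D) + (\<Sum>D\<in>{A, B}. phi_SSE x D)"
    using lt' by simp
  also have "\<dots> = (\<Sum>D\<in>l. phi_SSE x D)"
    using A B fl by (intro sum.subset_diff[symmetric]) auto
  finally show False
    using opt rep(1) A B card unfolding opt_partition_iff
    by (metis empty_subsetI insert_subset not_less)
qed

lemma OPT_le_OPT_unc:
  assumes "opt_partition n x K l" "\<And>A. A \<in> l \<Longrightarrow> induces_connected E A"
  shows "OPT n x E K \<le> OPT_unc n x K"
proof -
  have "OPT n x E K \<le> ereal (\<Sum>A\<in>l. phi_SSE x A)"
    unfolding OPT_def using assms by (intro INF_lower) (auto simp: opt_partition_iff)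
  also have "\<dots> \<le> OPT_unc n x K"
    unfolding OPT_unc_def using assms by (intro INF_greatest) (auto simp: opt_partition_iff)
  finally show ?thesis .
qed

section \<open>Connectedness of Voronoi blocks\<close>

text \<open>Place grid points on the segment at spacing at most \<open>r / 2\<close>. Each has a
  point of the block within \<open>r / 4\<close>, so points chosen at consecutive grid points are at
  distance at most \<open>r / 4 + r / 2 + r / 4 = r\<close>.\<close>

lemma induces_connected_if_covered:
  fixes x :: "nat \<Rightarrow> 'a::euclidean_space"
  assumes r: "r > 0"
    and cov: "\<And>i j z. i \<in> A \<Longrightarrow> j \<in> A \<Longrightarrow> z \<in> closed_segment (x i) (x j) \<Longrightarrow> \<exists>k\<in>A. dist (x k) z \<le> r / 4"
    and edge: "\<And>i j. i \<in> A \<Longrightarrow> j \<in> A \<Longrightarrow> i \<noteq> j \<Longrightarrow> dist (x i) (x j) \<le> r \<Longrightarrow> {i, j} \<in> E"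
  shows "induces_connected E A"
  unfolding induces_connected_def
proof (intro ballI)
  fix i j assume ij: "i \<in> A" "j \<in> A"
  let ?S = "{(u, v). u \<in> A \<and> v \<in> A \<and> {u, v} \<in> E}"
  have step: "(u, v) \<in> ?S\<^sup>*" if "u \<in> A" "v \<in> A" "dist (x u) (x v) \<le> r" for u v
    using edge[OF that(1,2) _ that(3)] that by (cases "u = v") auto
  obtain m :: nat where m: "dist (x i) (x j) / (r / 2) < real m"
    using reals_Archimedean2 by blast
  have m0: "real m > 0" using m r by (smt (verit) divide_nonneg_pos zero_le_dist half_gt_zero)
  define z where "z t = (1 - real t / m) *\<^sub>R x i + (real t / m) *\<^sub>R x j" for t :: nat
  have dz: "dist (z t) (z (Suc t)) \<le> r / 2" for t
  proof -
    have "z t - z (Suc t) = (1 / real m) *\<^sub>R (x i - x j)"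
      by (simp add: z_def algebra_simps add_divide_distrib)
    then have "dist (z t) (z (Suc t)) = dist (x i) (x j) / m"
      by (simp add: dist_norm)
    moreover have "dist (x i) (x j) / m \<le> r / 2"
      using m m0 r by (simp add: field_simps)
    ultimately show ?thesis by simp
  qed
  \<comment> \<open>Reachability is claimed for every point of \<open>A\<close> near
    \<open>z t\<close>, not for one chosen point: at \<open>t = m\<close> this covers
    \<open>j\<close> itself, since \<open>z m = x j\<close>.\<close>
  have "\<forall>k\<in>A. dist (x k) (z t) \<le> r / 4 \<longrightarrow> (i, k) \<in> ?S\<^sup>*" if "t \<le> m" for t
    using that
  proof (induction t)
    case 0
    have "(i, k) \<in> ?S\<^sup>*" if "k \<in> A" "dist (x k) (z 0) \<le> r / 4" for k
      by (rule step) (use that ij r in \<open>auto simp: z_def dist_commute\<close>)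
    then show ?case by blast
  next
    case (Suc t)
    have "z t \<in> closed_segment (x i) (x j)"
      unfolding z_def in_segment using Suc m0 by (intro exI[of _ "real t / m"]) auto
    then obtain k' where k': "k' \<in> A" "dist (x k') (z t) \<le> r / 4"
      using cov ij by blast
    have "(i, k) \<in> ?S\<^sup>*" if k: "k \<in> A" "dist (x k) (z (Suc t)) \<le> r / 4" for k
    proof -
      have "dist (x k') (x k) \<le> dist (x k') (z t) + dist (z t) (z (Suc t)) + dist (x k) (z (Suc t))"
        by (metis add.assoc add_left_mono dist_commute dist_triangle order_trans)
      then have "dist (x k') (x k) \<le> r" using k k' dz[of t] by linarith
      then have "(k', k) \<in> ?S\<^sup>*" using step k k' by blast
      moreover have "(i, k') \<in> ?S\<^sup>*" using Suc k' by simp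
      ultimately show ?thesis by (meson rtrancl_trans)
    qed
    then show ?case by blast
  qed
  from this[of m] show "(i, j) \<in> ?S\<^sup>*"
    using ij m0 r by (simp add: z_def)
qed

text \<open>
  The homothety with centre \<open>z\<close> and ratio \<open>\<kappa>\<close> maps the ball of radius \<open>a\<close> around the
  centre of a Voronoi cell, which lies in the cell, to a ball that still lies in the cell, by convexity.
\<close>

lemma voronoi_homothety:
  fixes z c d y :: "'a::euclidean_space"
  assumes z: "norm (z - c) \<le> norm (z - d)" and a: "2 * a \<le> norm (c - d)"
    and l: "0 < \<kappa>" "\<kappa> \<le> 1" and y: "norm (y - ((1 - \<kappa>) *\<^sub>R z + \<kappa> *\<^sub>R c)) < \<kappa> * a"
  shows "norm (y - c) < norm (y - d)"
proof -
  \<comment> \<open>The difference of the squared distances from \<open>p\<close> to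
    \<open>d\<close> and to \<open>c\<close>. The quadratic terms cancel, so \<open>\<phi>\<close>
    is affine, and its sign tells on which side of the bisector \<open>p\<close> lies.\<close>
  define \<phi> where "\<phi> p = 2 * (p \<bullet> (c - d)) + (d \<bullet> d - c \<bullet> c)" for p
  have \<phi>: "\<phi> p = (norm (p - d))\<^sup>2 - (norm (p - c))\<^sup>2" for p
    by (simp add: \<phi>_def power2_norm_eq_inner inner_diff inner_commute algebra_simps)
  \<comment> \<open>The preimage of \<open>y\<close> under the homothety.\<close>
  define u where "u = c + (1 / \<kappa>) *\<^sub>R (y - ((1 - \<kappa>) *\<^sub>R z + \<kappa> *\<^sub>R c))"
  have yu: "y = (1 - \<kappa>) *\<^sub>R z + \<kappa> *\<^sub>R u"
    using l by (simp add: u_def algebra_simps)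
  have "norm (u - c) = norm (y - ((1 - \<kappa>) *\<^sub>R z + \<kappa> *\<^sub>R c)) / \<kappa>"
    using l by (simp add: u_def)
  then have uc: "norm (u - c) < a"
    using y l by (simp add: pos_divide_less_eq mult.commute)
  have "norm (c - d) \<le> norm (u - c) + norm (u - d)"
    by (metis norm_minus_commute norm_triangle_sub diff_add_cancel norm_triangle_ineq add_diff_cancel_left' add_diff_eq)
  then have "norm (u - c) < norm (u - d)" using uc a by linarith
  then have "\<phi> u > 0" by (simp add: \<phi> power_strict_mono)
  moreover have "\<phi> z \<ge> 0" using z by (simp add: \<phi> power_mono)
  moreover have "\<phi> y = (1 - \<kappa>) * \<phi> z + \<kappa> * \<phi> u"
    unfolding \<phi>_def yu by (simp add: inner_add_left algebra_simps)
  ultimately have "\<phi> y > 0"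
    using l by (simp add: add_nonneg_pos)
  then show ?thesis by (simp add: \<phi> power2_less_imp_less)
qed

lemma norm_mean_point_le:
  fixes x :: "nat \<Rightarrow> 'a::euclidean_space"
  assumes "finite A" "A \<noteq> {}" "\<And>i. i \<in> A \<Longrightarrow> norm (x i) \<le> R"
  shows "norm (mean_point x A) \<le> R"
proof -
  have "norm (\<Sum>i\<in>A. x i) \<le> card A * R"
    using sum_norm_le[of A x "\<lambda>_. R"] assms by simp
  then show ?thesis
    using assms by (simp add: mean_point_def field_simps card_gt_0_iff)
qed

text \<open>A sample point in the shrunk ball is within \<open>\<kappa> * a\<close> of its centre
  \<open>w\<close>, and \<open>w\<close> is within \<open>\<kappa> * (2 * R)\<close> of
  \<open>z\<close>. The ratio \<open>\<kappa> = r / 4 / (2 * R + a)\<close> makes the sum equal to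
  \<open>r / 4\<close>, and the upper bound on \<open>r\<close> gives
  \<open>\<kappa> \<le> 1\<close>.\<close>

lemma optimal_block_connected:
  fixes x :: "nat \<Rightarrow> 'a::euclidean_space"
  assumes opt: "opt_partition n x K l" and A: "A \<in> l"
    and xR: "\<And>i. i \<in> {1..n} \<Longrightarrow> norm (x i) \<le> R"
    and sep: "\<And>B. B \<in> l \<Longrightarrow> B \<noteq> A \<Longrightarrow> 2 * a \<le> norm (mean_point x A - mean_point x B)"
    and marg: "norm (mean_point x A) \<le> R - a"
    and a: "a > 0" and r: "0 < r" "r \<le> 4 * (2 * R + a)" and R: "R > 0"
    and cov: "\<And>w. norm w \<le> R - r / 4 * (a / (2 * R + a)) \<Longrightarrow>
                \<exists>j\<in>{1..n}. dist w (x j) < r / 4 * (a / (2 * R + a))"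
    and edge: "\<And>i j. i \<in> {1..n} \<Longrightarrow> j \<in> {1..n} \<Longrightarrow> i \<noteq> j \<Longrightarrow> dist (x i) (x j) \<le> r \<Longrightarrow> {i, j} \<in> E"
  shows "induces_connected E A"
proof (rule induces_connected_if_covered[OF r(1)])
  have l: "partition_on {1..n} l" using opt by (simp add: opt_partition_iff)
  then have sub: "A \<subseteq> {1..n}" using A by (auto simp: partition_on_def)
  show "{i, j} \<in> E" if "i \<in> A" "j \<in> A" "i \<noteq> j" "dist (x i) (x j) \<le> r" for i j
    using edge that sub by blast
  fix i j z assume ij: "i \<in> A" "j \<in> A" and z: "z \<in> closed_segment (x i) (x j)"
  define \<kappa> where "\<kappa> = r / 4 / (2 * R + a)"
  have \<kappa>: "0 < \<kappa>" "\<kappa> \<le> 1" using a r R by (auto simp: \<kappa>_def field_simps)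
  have s: "r / 4 * (a / (2 * R + a)) = \<kappa> * a" by (simp add: \<kappa>_def)
  let ?c = "mean_point x A"
  have zR: "norm z \<le> R"
  proof -
    have "closed_segment (x i) (x j) \<subseteq> cball 0 R"
      using xR ij sub by (intro closed_segment_subset) auto
    then show ?thesis using z by auto
  qed
  have zc: "norm (z - ?c) \<le> norm (z - mean_point x B)" if "B \<in> l" for B
  proof -
    let ?d = "mean_point x B"
    \<comment> \<open>Being at least as near to \<open>?c\<close> as to \<open>?d\<close> is a
      half-space condition, so it passes from the two sample points at the ends to the whole
      segment.\<close>
    let ?S = "{p. 2 *\<^sub>R (?d - ?c) \<bullet> p \<le> ?d \<bullet> ?d - ?c \<bullet> ?c}"
    have eq: "p \<in> ?S \<longleftrightarrow> norm (p - ?c) \<le> norm (p - ?d)" for p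
      unfolding norm_le by (simp add: inner_diff inner_commute algebra_simps)
    have "closed_segment (x i) (x j) \<subseteq> ?S"
      using opt_partition_voronoi[OF opt A that] ij eq
      by (intro closed_segment_subset) (auto simp only: convex_halfspace_le)
    then show ?thesis using z eq by blast
  qed
  \<comment> \<open>Centre of the shrunk ball. The margin of the block mean keeps its norm at most
    \<open>R - \<kappa> * a\<close>, where \<open>cov\<close> supplies a sample point.\<close>
  define w where "w = (1 - \<kappa>) *\<^sub>R z + \<kappa> *\<^sub>R ?c"
  have "norm w \<le> (1 - \<kappa>) * norm z + \<kappa> * norm ?c"
    unfolding w_def using \<kappa> by (intro order_trans[OF norm_triangle_ineq]) auto
  also have "\<dots> \<le> (1 - \<kappa>) * R + \<kappa> * (R - a)"
    using \<kappa> zR marg by (intro add_mono mult_left_mono) auto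
  finally have "norm w \<le> R - \<kappa> * a" by (simp add: algebra_simps)
  then obtain k where k: "k \<in> {1..n}" "dist w (x k) < \<kappa> * a"
    using cov unfolding s by blast
  have kw: "norm (x k - w) < \<kappa> * a" using k by (simp add: dist_norm norm_minus_commute)
  obtain B where B: "B \<in> l" "k \<in> B" using k(1) unfolding partition_onD1[OF l] by blast
  \<comment> \<open>\<open>voronoi_homothety\<close> puts this sample point strictly nearer to the
    mean of \<open>A\<close>, so an optimal partition cannot have it in another block.\<close>
  have "B = A"
  proof (rule ccontr)
    assume BA: "B \<noteq> A"
    have "norm (x k - ?c) < norm (x k - mean_point x B)"
      by (rule voronoi_homothety[OF zc[OF B(1)] sep[OF B(1) BA] \<kappa>]) (use kw in \<open>simp add: w_def\<close>)
    then show False using opt_partition_voronoi[OF opt B(1) A B(2)] by simp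
  qed
  have "norm (x k - z) \<le> norm (x k - w) + norm (w - z)"
    by (metis norm_triangle_ineq diff_add_cancel add_diff_eq)
  also have "w - z = \<kappa> *\<^sub>R (?c - z)" by (simp add: w_def algebra_simps)
  also have "norm (\<kappa> *\<^sub>R (?c - z)) \<le> \<kappa> * (2 * R)"
    using \<kappa> norm_triangle_ineq4[of ?c z] zR marg a by auto
  finally have "norm (x k - z) \<le> \<kappa> * (2 * R + a)" using kw by (simp add: algebra_simps)
  also have "\<dots> = r / 4"
    using R a nonzero_eq_divide_eq[of "2 * R + a" \<kappa> "r / 4"] by (simp add: \<kappa>_def)
  finally show "\<exists>k\<in>A. dist (x k) z \<le> r / 4"
    using B \<open>B = A\<close> by (auto simp: dist_norm)
qed

text \<open>The points strictly nearer to \<open>x i\<close> than \<open>x j\<close>, and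
  \<open>x j\<close> itself, lie within \<open>r\<close> of \<open>x i\<close>, so the number of
  points there bounds the rank of \<open>j\<close>; adding \<open>j\<close> accounts for the initial
  \<open>1\<close> in \<open>nn_rank\<close>.\<close>

lemma nn_graph_edge:
  fixes x :: "nat \<Rightarrow> 'a::euclidean_space"
  assumes ij: "i \<in> {1..n}" "j \<in> {1..n}" "i \<noteq> j" "dist (x i) (x j) \<le> r"
    and q: "n - 1 \<le> q \<or> card {s \<in> {1..n} - {i}. dist (x i) (x s) \<le> r} \<le> q"
  shows "{i, j} \<in> nn_graph n x q"
proof -
  let ?S = "{s \<in> {1..n}. s \<notin> {i, j} \<and> norm (x i - x s) < norm (x i - x j)}"
  have j: "nn_rank n x i j = card (insert j ?S)"
    by (simp add: nn_rank_def)
  have "nn_rank n x i j \<le> q"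
  proof (cases "n - 1 \<le> q")
    case True
    have "card (insert j ?S) \<le> card ({1..n} - {i})"
      using ij by (intro card_mono) auto
    then show ?thesis using True ij j by simp
  next
    case False
    have "card (insert j ?S) \<le> card {s \<in> {1..n} - {i}. dist (x i) (x s) \<le> r}"
      using ij by (intro card_mono) (auto simp: dist_norm)
    then show ?thesis using False q j by simp
  qed
  then have "min (nn_rank n x i j) (nn_rank n x j i) \<le> q" by simp
  then show ?thesis
    unfolding nn_graph_def using ij by blast
qed

section \<open>Risks and uniform deviation\<close>

context
  fixes K :: nat
  assumes K: "1 \<le> K"
begin

lemma dist_to_centres_le_iff:
  "t \<le> dist_to_centres K c x \<longleftrightarrow> (\<forall>k\<in>{1..K}. t \<le> (norm (x - c k))\<^sup>2)"
  unfolding dist_to_centres_def using K by (subst Min_ge_iff) auto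

lemma dist_to_centres_le: "k \<in> {1..K} \<Longrightarrow> dist_to_centres K c x \<le> (norm (x - c k))\<^sup>2"
  using dist_to_centres_le_iff by blast

lemma dist_to_centres_nonneg: "0 \<le> dist_to_centres K c x"
  by (simp add: dist_to_centres_le_iff)

lemma dist_to_centres_bound:
  assumes "c \<in> centre_set K R"
  shows "dist_to_centres K c x \<le> (norm x + R)\<^sup>2"
proof -
  have "norm (c 1) \<le> R" using assms K by (auto simp: centre_set_def PiE_iff)
  then have "norm (x - c 1) \<le> norm x + R"
    by (intro order_trans[OF norm_triangle_ineq4]) simp
  then have "(norm (x - c 1))\<^sup>2 \<le> (norm x + R)\<^sup>2" by (intro power_mono) auto
  then show ?thesis using dist_to_centres_le[of 1 c x] K by simp
qed

lemma d_inf_ge: "k \<in> {1..K} \<Longrightarrow> norm (c k - c' k) \<le> d_inf K c c'"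
  unfolding d_inf_def by (intro Max_ge) auto

lemma d_inf_nonneg: "0 \<le> d_inf K c c'"
  using d_inf_ge[of 1 c c'] K by (meson atLeastAtMost_iff norm_ge_zero order_trans order_refl)

lemma d_inf_less_iff: "d_inf K c c' < t \<longleftrightarrow> (\<forall>k\<in>{1..K}. norm (c k - c' k) < t)"
  unfolding d_inf_def using K by (subst Max_less_iff) auto

lemma d_inf_commute: "d_inf K c c' = d_inf K c' c"
  unfolding d_inf_def by (simp add: norm_minus_commute)

text \<open>Each squared distance changes by a difference of norms, at most
  \<open>d_inf K c c'\<close>, times a sum of norms, at most \<open>2 * norm x + 2 * R\<close>.
  Bounding every term of the minimum for \<open>c'\<close> from below gives one side; exchanging
  \<open>c\<close> and \<open>c'\<close> gives the other.\<close>

lemma dist_to_centres_lipschitz_aux: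
  assumes "c \<in> centre_set K R" "c' \<in> centre_set K R"
  shows "dist_to_centres K c x - d_inf K c c' * (2 * norm x + 2 * R) \<le> dist_to_centres K c' x"
  unfolding dist_to_centres_le_iff[of _ c']
proof
  fix k assume k: "k \<in> {1..K}"
  have n: "norm (c k) \<le> R" "norm (c' k) \<le> R"
    using k assms by (auto simp: centre_set_def PiE_iff)
  have "(norm (x - c k))\<^sup>2 - (norm (x - c' k))\<^sup>2
      = (norm (x - c k) - norm (x - c' k)) * (norm (x - c k) + norm (x - c' k))"
    by (simp add: power2_eq_square algebra_simps)
  also have "\<dots> \<le> d_inf K c c' * (2 * norm x + 2 * R)"
  proof (rule mult_mono)
    have "norm (x - c k) - norm (x - c' k) \<le> norm (c k - c' k)"
      using norm_triangle_ineq2[of "x - c k" "x - c' k"] by (simp add: norm_minus_commute)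
    then show "norm (x - c k) - norm (x - c' k) \<le> d_inf K c c'"
      using d_inf_ge[OF k, of c c'] by simp
    show "norm (x - c k) + norm (x - c' k) \<le> 2 * norm x + 2 * R"
      using norm_triangle_ineq4[of x "c k"] norm_triangle_ineq4[of x "c' k"] n by simp
  qed (auto simp: d_inf_nonneg)
  finally show "dist_to_centres K c x - d_inf K c c' * (2 * norm x + 2 * R) \<le> (norm (x - c' k))\<^sup>2"
    using dist_to_centres_le[OF k, of c x] by simp
qed

lemma dist_to_centres_lipschitz:
  assumes "c \<in> centre_set K R" "c' \<in> centre_set K R"
  shows "\<bar>dist_to_centres K c x - dist_to_centres K c' x\<bar> \<le> d_inf K c c' * (2 * norm x + 2 * R)"
  using dist_to_centres_lipschitz_aux[OF assms, of x] dist_to_centres_lipschitz_aux[OF assms(2,1), of x]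
  unfolding d_inf_commute[of c' c] by linarith

lemma borel_measurable_dist_to_centres [measurable]:
  "dist_to_centres K c \<in> borel_measurable borel"
proof -
  have eq: "dist_to_centres K c = (\<lambda>x. Min ((\<lambda>k. (norm (x - c k))\<^sup>2) ` {1..K}))"
    by (simp add: dist_to_centres_def fun_eq_iff)
  show ?thesis unfolding eq by measurable
qed

section \<open>Population and empirical risk for a law with finite second moment\<close>

context
  fixes P :: "'a::euclidean_space measure" and R :: real
  assumes P: "prob_space P" and sets_P [measurable_cong]: "sets P = sets borel"
    and P2: "integrable P (\<lambda>x. (norm x)\<^sup>2)" and R: "R > 0"
begin

interpretation P: prob_space P by (rule P)

lemma integrable_norm_P: "integrable P norm"
proof (rule Bochner_Integration.integrable_bound)
  show "integrable P (\<lambda>x. 1 + (norm x)\<^sup>2)" using P2 by simp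
  have "norm x \<le> 1 + (norm x)\<^sup>2" for x :: 'a
  proof -
    have "0 \<le> (norm x - 1)\<^sup>2 + (norm x)\<^sup>2 + 1" by simp
    then show ?thesis by (simp add: power2_eq_square algebra_simps)
  qed
  then show "AE x in P. norm (norm x) \<le> norm (1 + (norm x)\<^sup>2)" by auto
qed simp

lemma integrable_norm_plus_sq: "integrable P (\<lambda>x. (norm x + R)\<^sup>2)"
  using P2 integrable_norm_P by (simp add: power2_sum)

lemma integrable_dist_to_centres:
  assumes "c \<in> centre_set K R"
  shows "integrable P (dist_to_centres K c)"
  by (rule Bochner_Integration.integrable_bound[OF integrable_norm_plus_sq])
     (simp_all add: dist_to_centres_bound[OF assms] dist_to_centres_nonneg)

lemma pop_risk_bounds:
  assumes "c \<in> centre_set K R"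
  shows "0 \<le> pop_risk P K c" "pop_risk P K c \<le> (\<integral>x. (norm x + R)\<^sup>2 \<partial>P)"
  unfolding pop_risk_def
  by (simp_all add: integral_mono dist_to_centres_bound[OF assms] dist_to_centres_nonneg
      integrable_dist_to_centres[OF assms] integrable_norm_plus_sq)

lemma pop_risk_lipschitz:
  assumes "c \<in> centre_set K R" "c' \<in> centre_set K R"
  shows "\<bar>pop_risk P K c - pop_risk P K c'\<bar> \<le> d_inf K c c' * (2 * (\<integral>x. norm x \<partial>P) + 2 * R)"
proof -
  note int = integrable_dist_to_centres[OF assms(1)] integrable_dist_to_centres[OF assms(2)]
  have "\<bar>pop_risk P K c - pop_risk P K c'\<bar> = \<bar>\<integral>x. dist_to_centres K c x - dist_to_centres K c' x \<partial>P\<bar>"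
    unfolding pop_risk_def using int by simp
  also have "\<dots> \<le> (\<integral>x. \<bar>dist_to_centres K c x - dist_to_centres K c' x\<bar> \<partial>P)"
    by (rule integral_abs_bound)
  also have "\<dots> \<le> (\<integral>x. d_inf K c c' * (2 * norm x + 2 * R) \<partial>P)"
    using dist_to_centres_lipschitz[OF assms] int integrable_norm_P by (intro integral_mono) auto
  also have "\<dots> = d_inf K c c' * (2 * (\<integral>x. norm x \<partial>P) + 2 * R)"
    using integrable_norm_P by (simp add: P.prob_space)
  finally show ?thesis .
qed

lemma emp_risk_bounds:
  assumes "c \<in> centre_set K R"
  shows "0 \<le> emp_risk n x K c" "emp_risk n x K c \<le> (1 / real n) * (\<Sum>i=1..n. (norm (x i) + R)\<^sup>2)"
  unfolding emp_risk_def
  by (auto intro!: mult_nonneg_nonneg divide_nonneg_nonneg sum_nonneg sum_mono divide_right_mono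
      dist_to_centres_bound[OF assms] dist_to_centres_nonneg simp del: One_nat_def)

lemma emp_risk_lipschitz:
  assumes "c \<in> centre_set K R" "c' \<in> centre_set K R"
  shows "\<bar>emp_risk n x K c - emp_risk n x K c'\<bar>
    \<le> d_inf K c c' * ((1 / real n) * (\<Sum>i=1..n. 2 * norm (x i) + 2 * R))"
proof -
  have "\<bar>emp_risk n x K c - emp_risk n x K c'\<bar>
      = (1 / real n) * \<bar>\<Sum>i=1..n. dist_to_centres K c (x i) - dist_to_centres K c' (x i)\<bar>"
    unfolding emp_risk_def by (simp add: sum_subtractf abs_mult flip: right_diff_distrib diff_divide_distrib)
  also have "\<dots> \<le> (1 / real n) * (\<Sum>i=1..n. d_inf K c c' * (2 * norm (x i) + 2 * R))"
    using dist_to_centres_lipschitz[OF assms]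
    by (intro mult_left_mono order_trans[OF sum_abs] sum_mono) auto
  finally show ?thesis by (simp add: sum_distrib_left mult.left_commute)
qed

lemma bdd_above_deviation:
  "bdd_above ((\<lambda>c. \<bar>emp_risk n x K c - pop_risk P K c\<bar>) ` centre_set K R)"
proof (rule bdd_aboveI2)
  fix c :: "nat \<Rightarrow> 'a" assume "c \<in> centre_set K R"
  from emp_risk_bounds[OF this, of n x] pop_risk_bounds[OF this]
  show "\<bar>emp_risk n x K c - pop_risk P K c\<bar> \<le>
      (1 / real n) * (\<Sum>i=1..n. (norm (x i) + R)\<^sup>2) + (\<integral>x. (norm x + R)\<^sup>2 \<partial>P)"
    by (auto simp: abs_le_iff)
qed

lemma deviation_le_unif_dev:
  "c \<in> centre_set K R \<Longrightarrow> \<bar>emp_risk n x K c - pop_risk P K c\<bar> \<le> unif_dev n x P K R"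
  unfolding unif_dev_def by (intro cSUP_upper bdd_above_deviation)

text \<open>For a fixed sample both risks are Lipschitz in the centres, so the deviation at any
  tuple is approximated by its values on \<open>D\<close>. The lemma is applied to a countable
  \<open>D\<close>.\<close>

lemma unif_dev_eq_SUP_dense:
  assumes D: "D \<subseteq> centre_set K R" "D \<noteq> {}"
    and dense: "\<And>c e. c \<in> centre_set K R \<Longrightarrow> e > 0 \<Longrightarrow> \<exists>c'\<in>D. d_inf K c c' < e"
  shows "unif_dev n x P K R = (SUP c\<in>D. \<bar>emp_risk n x K c - pop_risk P K c\<bar>)"
proof (rule antisym)
  let ?g = "\<lambda>c. \<bar>emp_risk n x K c - pop_risk P K c\<bar>"
  have bdd: "bdd_above (?g ` D)"
    by (rule bdd_above_mono[OF bdd_above_deviation]) (use D in auto)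
  define L where "L = (1 / real n) * (\<Sum>i=1..n. 2 * norm (x i) + 2 * R) + (2 * (\<integral>x. norm x \<partial>P) + 2 * R)"
  have "0 \<le> (1 / real n) * (\<Sum>i=1..n. 2 * norm (x i) + 2 * R)"
    using R by (intro mult_nonneg_nonneg sum_nonneg) auto
  moreover have "0 \<le> (\<integral>x. norm x \<partial>P)" by simp
  ultimately have L: "L > 0" using R unfolding L_def by linarith
  show "unif_dev n x P K R \<le> (SUP c\<in>D. ?g c)"
    unfolding unif_dev_def
  proof (rule cSUP_least)
    show "centre_set K R \<noteq> ({} :: (nat \<Rightarrow> 'a) set)" using D by auto
    fix c :: "nat \<Rightarrow> 'a" assume c: "c \<in> centre_set K R"
    show "?g c \<le> (SUP c\<in>D. ?g c)"
    proof (rule field_le_epsilon)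
      fix e :: real assume e: "e > 0"
      obtain c' where c': "c' \<in> D" "d_inf K c c' < e / L"
        using dense[OF c, of "e / L"] e L by auto
      have "c' \<in> centre_set K R" using c' D by auto
      from emp_risk_lipschitz[OF c this, of n x] pop_risk_lipschitz[OF c this]
      have "?g c \<le> ?g c' + d_inf K c c' * L"
        unfolding L_def ring_distribs by linarith
      also have "d_inf K c c' * L \<le> e"
        using c'(2) L by (simp add: pos_less_divide_eq)
      also have "?g c' \<le> (SUP c\<in>D. ?g c)"
        by (rule cSUP_upper[OF c'(1) bdd])
      finally show "?g c \<le> (SUP c\<in>D. ?g c) + e" by simp
    qed
  qed
  show "(SUP c\<in>D. ?g c) \<le> unif_dev n x P K R"
    unfolding unif_dev_def by (rule cSUP_subset_mono[OF D(2) bdd_above_deviation D(1)]) simp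
qed

text \<open>A supremum over a countable dense set of tuples is measurable. The event in
  \<open>zeta\<close> is thereby measurable; \<open>measure\<close> would be 0 by default on a set
  that is not.\<close>

lemma borel_measurable_unif_dev:
  assumes [measurable]: "\<And>i. i \<in> {1..n} \<Longrightarrow> X i \<in> M \<rightarrow>\<^sub>M borel"
  shows "(\<lambda>\<omega>. unif_dev n (\<lambda>i. X i \<omega>) P K R) \<in> borel_measurable M"
proof -
  obtain T :: "'a set" where T: "countable T" "T \<subseteq> cball 0 R" "cball 0 R \<subseteq> closure T"
    using separable by blast
  define D where "D = {1..K} \<rightarrow>\<^sub>E T"
  have D: "D \<subseteq> centre_set K R" unfolding D_def centre_set_def using T by (intro PiE_mono) auto
  have cD: "countable D" unfolding D_def using T by (intro countable_PiE) auto
  have dense: "\<exists>c'\<in>D. d_inf K c c' < e" if c: "c \<in> centre_set K R" and e: "e > 0" for c e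
  proof -
    have "\<exists>t\<in>T. dist t (c k) < e" if "k \<in> {1..K}" for k
    proof -
      have "c k \<in> closure T" using c T that by (auto simp: centre_set_def PiE_iff)
      then show ?thesis using e by (simp add: closure_approachable)
    qed
    then obtain t where t: "\<And>k. k \<in> {1..K} \<Longrightarrow> t k \<in> T \<and> dist (t k) (c k) < e" by metis
    have "restrict t {1..K} \<in> D" using t by (simp add: D_def PiE_iff)
    moreover have "d_inf K c (restrict t {1..K}) < e"
      unfolding d_inf_less_iff using t by (auto simp: dist_norm norm_minus_commute)
    ultimately show ?thesis by blast
  qed
  have "restrict (\<lambda>_. 0) {1..K} \<in> centre_set K R" using R by (auto simp: centre_set_def)
  then have "D \<noteq> {}" using dense[of _ 1] by fastforce
  then have eq: "unif_dev n x P K R = (SUP c\<in>D. \<bar>emp_risk n x K c - pop_risk P K c\<bar>)" for x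
    by (rule unif_dev_eq_SUP_dense[OF D]) (rule dense)
  have [measurable]: "(\<lambda>\<omega>. emp_risk n (\<lambda>i. X i \<omega>) K c) \<in> borel_measurable M" for c
    unfolding emp_risk_def by measurable
  show ?thesis
    unfolding eq
  proof (rule borel_measurable_cSUP[OF cD])
    show "bdd_above ((\<lambda>c. \<bar>emp_risk n (\<lambda>i. X i \<omega>) K c - pop_risk P K c\<bar>) ` D)" for \<omega>
      by (rule bdd_above_mono[OF bdd_above_deviation]) (use D in auto)
  qed measurable
qed

text \<open>
  Comparing the empirical and the population risk of \<open>c\<close> and of an optimal tuple costs
  at most one uniform deviation each, so the excess population risk of \<open>c\<close> is at most twice
  the uniform deviation.
\<close>

lemma near_optimal_centres:
  assumes c: "c \<in> centre_set K R" and ne: "opt_centres P K R \<noteq> {}"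
    and emp: "\<And>c'. emp_risk n x K c \<le> emp_risk n x K c'"
    and gap: "\<not> risk_gap P K R \<epsilon> \<le> ereal (2 * unif_dev n x P K R)"
  obtains c' where "c' \<in> opt_centres P K R" "d_inf K c c' < \<epsilon>"
proof -
  obtain c0 where c0: "c0 \<in> opt_centres P K R" using ne by blast
  then have c0': "c0 \<in> centre_set K R" "pop_risk P K c0 = opt_risk P K"
    by (auto simp: opt_centres_def)
  have "pop_risk P K c - opt_risk P K \<le> 2 * unif_dev n x P K R"
    using deviation_le_unif_dev[OF c, of n x] deviation_le_unif_dev[OF c0'(1), of n x] emp[of c0] c0'(2)
    by linarith
  moreover have "risk_gap P K R \<epsilon> \<le> ereal (pop_risk P K c - opt_risk P K)"
    if "\<epsilon> \<le> dist_to_opt P K R c"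
    unfolding risk_gap_def using c that by (intro INF_lower) auto
  ultimately have "dist_to_opt P K R c < \<epsilon>"
    using gap by (meson ereal_less_eq(3) not_le order_trans)
  then obtain c' where "c' \<in> opt_centres P K R" "d_inf K c c' < \<epsilon>"
    unfolding dist_to_opt_def using ne d_inf_nonneg
    by (subst (asm) cINF_less_iff) (auto intro!: bdd_belowI2[where m = 0])
  then show ?thesis by (rule that)
qed

text \<open>Each of the two centres lies within \<open>\<epsilon>\<^sub>0\<close> of its optimal
  counterpart, so their separation drops by at most \<open>2 * \<epsilon>\<^sub>0\<close>; half of
  what remains is the first term of \<open>a_zero\<close>.\<close>

lemma centres_separated:
  assumes c': "c' \<in> opt_centres P K R" and d: "d_inf K c c' < \<epsilon>\<^sub>0"
    and kl: "k \<in> {1..K}" "l \<in> {1..K}" "k \<noteq> l"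
  shows "2 * a_zero P K R \<epsilon>\<^sub>0 \<le> norm (c k - c l)"
proof -
  let ?S = "{norm (c k - c l) | c k l. c \<in> opt_centres P K R \<and> k \<in> {1..K} \<and> l \<in> {1..K} \<and> k \<noteq> l}"
  have "bdd_below ?S" by (rule bdd_belowI[of _ 0]) auto
  then have "centre_sep P K R \<le> norm (c' k - c' l)"
    unfolding centre_sep_def using c' kl by (intro cInf_lower) auto
  also have "c' k - c' l = (c k - c l) + (c' k - c k) + (c l - c' l)" by simp
  also have "norm \<dots> \<le> norm (c k - c l) + norm (c k - c' k) + norm (c l - c' l)"
    by (metis (no_types) norm_triangle_mono norm_minus_commute order_refl)
  moreover have "norm (c k - c' k) < \<epsilon>\<^sub>0" "norm (c l - c' l) < \<epsilon>\<^sub>0"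
    using d kl by (simp_all add: d_inf_less_iff)
  ultimately have "centre_sep P K R \<le> norm (c k - c l) + 2 * \<epsilon>\<^sub>0" by linarith
  then show ?thesis by (auto simp: a_zero_def min_def)
qed

lemma centres_margin:
  assumes c': "c' \<in> opt_centres P K R" and d: "d_inf K c c' < \<epsilon>\<^sub>0" and k: "k \<in> {1..K}"
  shows "norm (c k) \<le> R - a_zero P K R \<epsilon>\<^sub>0"
proof -
  let ?S = "{R - norm (c k) | c k. c \<in> opt_centres P K R \<and> k \<in> {1..K}}"
  have "bdd_below ?S" by (rule bdd_belowI[of _ 0]) (auto simp: opt_centres_def centre_set_def PiE_iff)
  then have "centre_margin P K R \<le> R - norm (c' k)"
    unfolding centre_margin_def using c' k by (intro cInf_lower) auto
  moreover have "norm (c k - c' k) < \<epsilon>\<^sub>0" using d k by (simp add: d_inf_less_iff)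
  then have "norm (c k) \<le> norm (c' k) + \<epsilon>\<^sub>0"
    using norm_triangle_sub[of "c k" "c' k"] by linarith
  ultimately show ?thesis by (simp add: a_zero_def)
qed

text \<open>Two centres of an optimal tuple have norm at most \<open>R - a_zero\<close> and are at
  least \<open>2 * a_zero\<close> apart, so the triangle inequality gives
  \<open>2 * a_zero \<le> 2 * (R - a_zero)\<close>.\<close>

lemma a_zero_le_half:
  assumes "opt_centres P K R \<noteq> {}" "2 \<le> K" "0 < \<epsilon>\<^sub>0"
  shows "a_zero P K R \<epsilon>\<^sub>0 \<le> R / 2"
proof -
  obtain c where c: "c \<in> opt_centres P K R" using assms by blast
  have d: "d_inf K c c < \<epsilon>\<^sub>0" using assms by (simp add: d_inf_less_iff)
  have "2 * a_zero P K R \<epsilon>\<^sub>0 \<le> norm (c 1 - c 2)"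
    by (rule centres_separated[OF c d]) (use assms in auto)
  moreover have "norm (c 1) \<le> R - a_zero P K R \<epsilon>\<^sub>0" "norm (c 2) \<le> R - a_zero P K R \<epsilon>\<^sub>0"
    by (rule centres_margin[OF c d]; use assms in simp)+
  ultimately show ?thesis using norm_triangle_ineq4[of "c 1" "c 2"] by linarith
qed

end

end

lemma a_zero_pos:
  assumes "0 < \<epsilon>\<^sub>0" "\<epsilon>\<^sub>0 < min (centre_sep P K R / 4) (centre_margin P K R / 2)"
  shows "0 < a_zero P K R \<epsilon>\<^sub>0"
  using assms by (auto simp: a_zero_def)

section \<open>Hitting all balls of a fixed radius\<close>

text \<open>Volume packing: the balls of radius \<open>\<sigma> / 2\<close> around the points are
  disjoint and contained in the ball of radius \<open>R\<close>.\<close>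

lemma card_separated_le:
  fixes T :: "'a::euclidean_space set"
  assumes fin: "finite T" and sub: "T \<subseteq> cball 0 \<rho>" and \<sigma>: "\<sigma> > 0" and R: "\<rho> + \<sigma> / 2 \<le> R" "R > 0"
    and sep: "pairwise (\<lambda>u v. \<sigma> \<le> dist u v) T"
  shows "real (card T) \<le> (2 * R / \<sigma>) ^ DIM('a)"
proof -
  let ?v = "unit_ball_vol (real DIM('a))"
  let ?B = "\<lambda>u::'a. ball u (\<sigma> / 2)"
  have "disjoint_family_on ?B T"
    unfolding disjoint_family_on_def
  proof (intro ballI impI)
    fix u v assume "u \<in> T" "v \<in> T" "u \<noteq> v"
    then have "\<sigma> \<le> dist u v" using sep by (auto simp: pairwise_def)
    then show "?B u \<inter> ?B v = {}" by (intro disjoint_ballI) simp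
  qed
  then have "(\<Sum>u\<in>T. emeasure lborel (?B u)) = emeasure lborel (\<Union>u\<in>T. ?B u)"
    using fin by (intro sum_emeasure) auto
  also have "\<dots> \<le> emeasure lborel (cball 0 R :: 'a set)"
  proof (rule emeasure_mono)
    show "(\<Union>u\<in>T. ?B u) \<subseteq> cball 0 R"
    proof (intro UN_least subsetI)
      fix u y assume "u \<in> T" "y \<in> ?B u"
      then have "norm u \<le> \<rho>" "norm (u - y) < \<sigma> / 2" using sub by (auto simp: dist_norm)
      then show "y \<in> cball 0 R"
        using norm_triangle_sub[of y u] R by (simp add: norm_minus_commute)
    qed
  qed simp
  finally have "ennreal (real (card T) * (?v * (\<sigma> / 2) ^ DIM('a))) \<le> ennreal (?v * R ^ DIM('a))"
    using \<sigma> R by (simp add: emeasure_ball emeasure_cball ennreal_mult ennreal_of_nat_eq_real_of_nat)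
  then have "real (card T) * (?v * (\<sigma> / 2) ^ DIM('a)) \<le> ?v * R ^ DIM('a)"
    using R by (subst (asm) ennreal_le_iff) auto
  then have "real (card T) * (\<sigma> / 2) ^ DIM('a) \<le> R ^ DIM('a)"
    using unit_ball_vol_pos[of "real DIM('a)"] by (simp add: mult.left_commute)
  then have "real (card T) \<le> R ^ DIM('a) / (\<sigma> / 2) ^ DIM('a)"
    using \<sigma> by (simp add: pos_le_divide_eq)
  also have "\<dots> = (2 * R / \<sigma>) ^ DIM('a)"
    by (simp add: power_divide power_mult_distrib)
  finally show ?thesis .
qed

text \<open>A separated set of greatest cardinality is a net, since an uncovered point could be
  added to it. The packing bound ensures that a greatest cardinality exists.\<close>

lemma finite_net_cball:
  fixes \<rho> \<sigma> R :: real
  assumes \<sigma>: "\<sigma> > 0" and R: "\<rho> + \<sigma> / 2 \<le> R" "R > 0"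
  obtains T :: "'a::euclidean_space set" where "finite T" "T \<subseteq> cball 0 \<rho>"
    "\<And>w. w \<in> cball 0 \<rho> \<Longrightarrow> \<exists>u\<in>T. dist w u < \<sigma>" "real (card T) \<le> (2 * R / \<sigma>) ^ DIM('a)"
proof -
  let ?Q = "\<lambda>T::'a set. finite T \<and> T \<subseteq> cball 0 \<rho> \<and> pairwise (\<lambda>u v. \<sigma> \<le> dist u v) T"
  have bound: "real (card T) \<le> (2 * R / \<sigma>) ^ DIM('a)" if "?Q T" for T :: "'a set"
    using card_separated_le[of T \<rho> \<sigma> R] that \<sigma> R by blast
  have "card T < Suc (nat \<lfloor>(2 * R / \<sigma>) ^ DIM('a)\<rfloor>)" if "?Q T" for T :: "'a set"
    using bound[OF that] by (simp add: less_Suc_eq_le le_nat_floor)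
  moreover have "?Q {}" by simp
  ultimately obtain T where T: "?Q T" "\<And>T'. ?Q T' \<Longrightarrow> card T' \<le> card T"
    using ex_has_greatest_nat[of ?Q "{}" card "Suc (nat \<lfloor>(2 * R / \<sigma>) ^ DIM('a)\<rfloor>)"] by blast
  have "\<exists>u\<in>T. dist w u < \<sigma>" if w: "w \<in> cball 0 \<rho>" for w
  proof (rule ccontr)
    assume *: "\<not> (\<exists>u\<in>T. dist w u < \<sigma>)"
    then have "w \<notin> T" using \<sigma> by auto
    moreover have "?Q (insert w T)"
      using T(1) w * by (auto simp: pairwise_insert dist_commute not_less)
    ultimately show False using T(2)[of "insert w T"] T(1) by simp
  qed
  then show ?thesis using that T(1) bound by blast
qed

section \<open>Mass of balls under the density bounds, and the probability of missing them\<close>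

lemma density_measure_bounds:
  fixes P :: "'a::euclidean_space measure"
  assumes P: "prob_space P" "P = density lborel (\<lambda>x. ennreal (f x))" and f [measurable]: "f \<in> borel_measurable borel"
    and A [measurable]: "A \<in> sets borel" and v: "emeasure lborel A = ennreal v" "0 \<le> v"
  shows "0 \<le> c \<Longrightarrow> (\<And>x. x \<in> A \<Longrightarrow> c \<le> f x) \<Longrightarrow> c * v \<le> measure P A"
    and "0 \<le> c \<Longrightarrow> (\<And>x. x \<in> A \<Longrightarrow> f x \<le> c) \<Longrightarrow> measure P A \<le> c * v"
proof -
  interpret prob_space P by (rule P)
  have e: "ennreal (measure P A) = (\<integral>\<^sup>+x. ennreal (f x) * indicator A x \<partial>lborel)"
    unfolding emeasure_eq_measure[symmetric] by (subst P(2)) (simp add: emeasure_density)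
  have cv: "ennreal (c * v) = (\<integral>\<^sup>+x. ennreal c * indicator A x \<partial>lborel)" if "0 \<le> c"
    using that v by (simp add: nn_integral_cmult_indicator ennreal_mult)
  show "c * v \<le> measure P A" if "0 \<le> c" "\<And>x. x \<in> A \<Longrightarrow> c \<le> f x"
  proof -
    have "ennreal (c * v) \<le> ennreal (measure P A)"
      unfolding e cv[OF that(1)] using that(2)
      by (intro nn_integral_mono) (auto simp: indicator_def intro: ennreal_leI)
    then show ?thesis by simp
  qed
  show "measure P A \<le> c * v" if "0 \<le> c" "\<And>x. x \<in> A \<Longrightarrow> f x \<le> c"
  proof -
    have "ennreal (measure P A) \<le> ennreal (c * v)"
      unfolding e cv[OF that(1)] using that(2)
      by (intro nn_integral_mono) (auto simp: indicator_def intro: ennreal_leI)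
    then show ?thesis using that v by (simp add: ennreal_le_iff)
  qed
qed

text \<open>By independence the probability is a product of \<open>n\<close> factors
  \<open>1 - measure P B\<close>, each at most \<open>exp (- p)\<close>.\<close>

lemma (in prob_space) prob_no_hit_le:
  fixes X :: "nat \<Rightarrow> 'a \<Rightarrow> 'b::euclidean_space"
  assumes ind: "indep_vars (\<lambda>_. borel) X {1..n}" and n: "1 \<le> n"
    and dist: "\<And>i. i \<in> {1..n} \<Longrightarrow> distr M borel (X i) = P"
    and B [measurable]: "B \<in> sets borel" and p: "p \<le> measure P B"
  shows "{\<omega>\<in>space M. \<forall>i\<in>{1..n}. X i \<omega> \<notin> B} \<in> events"
    "prob {\<omega>\<in>space M. \<forall>i\<in>{1..n}. X i \<omega> \<notin> B} \<le> exp (- (real n * p))"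
proof -
  have X [measurable]: "X i \<in> M \<rightarrow>\<^sub>M borel" if "i \<in> {1..n}" for i
    using ind that by (auto simp: indep_vars_def)
  show "{\<omega>\<in>space M. \<forall>i\<in>{1..n}. X i \<omega> \<notin> B} \<in> events"
    by measurable
  have eq: "{\<omega>\<in>space M. \<forall>i\<in>{1..n}. X i \<omega> \<notin> B} = (\<Inter>i\<in>{1..n}. X i -` (- B) \<inter> space M)"
    using n by auto
  have one: "prob (X i -` (- B) \<inter> space M) \<le> exp (- p)" if i: "i \<in> {1..n}" for i
  proof -
    interpret P: prob_space P
      using prob_space_distr[OF X[OF i]] dist[OF i] by simp
    have "prob (X i -` (- B) \<inter> space M) = measure (distr M borel (X i)) (- B)"
      using X[OF i] by (subst measure_distr) auto
    also have "\<dots> = measure P (space P - B)"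
      using dist[OF i] by (metis Compl_eq_Diff_UNIV space_borel space_distr)
    also have "\<dots> = 1 - measure P B"
      using dist[OF i] B by (intro P.prob_compl) (metis sets_distr)
    also have "\<dots> \<le> exp (- p)" using p exp_ge_add_one_self[of "- p"] by linarith
    finally show ?thesis .
  qed
  have "prob (\<Inter>i\<in>{1..n}. X i -` (- B) \<inter> space M) = (\<Prod>i\<in>{1..n}. prob (X i -` (- B) \<inter> space M))"
    using n by (intro indep_varsD[OF ind]) auto
  also have "\<dots> \<le> (\<Prod>i\<in>{1..n}. exp (- p))"
    using one by (intro prod_mono) auto
  also have "\<dots> = exp (real n * (- p))" by (subst exp_of_nat_mult) simp
  also have "\<dots> = exp (- (real n * p))" by (simp only: mult_minus_right)
  finally show "prob {\<omega>\<in>space M. \<forall>i\<in>{1..n}. X i \<omega> \<notin> B} \<le> exp (- (real n * p))"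
    unfolding eq .
qed

text \<open>For \<open>d > 0\<close> the right-hand side is the reciprocal of
  \<open>(1 + 1 / d) ^ d\<close>, which is at most \<open>exp 1\<close>. Shrinking a radius by the
  factor \<open>1 - 1 / (d + 1)\<close> thus costs at most a factor 4 of volume, which is the 4 in
  the exponent of \<open>Psi\<close>.\<close>

lemma shrunk_ratio_power_ge: "1 / 4 \<le> (1 - 1 / (real d + 1)) ^ d"
proof (cases "d = 0")
  case False
  then have d: "real d > 0" by simp
  have eq: "1 - 1 / (real d + 1) = 1 / (1 + 1 / real d)" using d by (simp add: field_simps)
  have "(1 + 1 / real d) ^ d \<le> exp (1 / real d) ^ d"
    by (intro power_mono exp_ge_add_one_self) auto
  also have "\<dots> = exp 1" using d by (simp flip: exp_of_nat_mult)
  also have "\<dots> \<le> 4" using exp_le by simp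
  finally have "(1 + 1 / real d) ^ d \<le> 4" .
  moreover have "(1 + 1 / real d) ^ d > 0" using d by (intro zero_less_power) (simp add: add_pos_pos)
  ultimately show ?thesis unfolding eq by (simp add: power_one_over field_simps)
qed simp

text \<open>
  When the bound \<open>Psi\<close> is nontrivial, \<open>n * \<eta> > 4 * v\<close>, so that \<open>n / v\<close> exceeds the
  volume ratio \<open>(R / s) ^ d\<close> and the combinatorial factor of \<open>Psi\<close> dominates the size of a net.
\<close>

lemma net_size_times_exp_le_Psi:
  assumes v: "d + 2 \<le> v" "v \<le> n" and s: "0 < s" "2 * s \<le> R" and c: "0 < c" "c * R ^ d \<le> 1"
    and \<eta>: "\<eta> = c * s ^ d" and Psi: "Psi n \<eta> v < 1"
  shows "(2 * R * (real d + 1) / s) ^ d * exp (- (real n * \<eta> / 4)) \<le> Psi n \<eta> v"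
proof -
  define y where "y = real n / real v"
  have v0: "real v > 0" using v by simp
  have y: "y \<ge> 1" using v v0 by (simp add: y_def)
  have R: "R > 0" using s by simp
  define E where "E = exp (- (real n * \<eta> / 4))"
  have Psi_eq: "Psi n \<eta> v = min 1 (2 * (2 * exp 1 * y) ^ v * E)"
    by (simp add: Psi_def y_def E_def)
  with Psi have P1: "2 * (2 * exp 1 * y) ^ v * E < 1" by (simp add: min_def split: if_splits)
  \<comment> \<open>Since \<open>y \<ge> 1\<close>, the combinatorial factor is at least
    \<open>exp v\<close>; as \<open>Psi\<close> is below 1, the exponential has to beat this, which
    forces \<open>4 * v < n * \<eta>\<close>.\<close>
  have "exp 1 * 1 \<le> 2 * exp 1 * y" using y by (intro mult_mono) auto
  then have "exp 1 ^ v \<le> (2 * exp 1 * y) ^ v" by (intro power_mono) auto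
  moreover have "exp 1 ^ v = exp (real v)" using exp_of_nat_mult[of v "1::real"] by simp
  moreover have "0 \<le> (2 * exp 1 * y) ^ v" using y by simp
  ultimately have "exp (real v) \<le> 2 * (2 * exp 1 * y) ^ v" by linarith
  then have "exp (real v) * E \<le> 2 * (2 * exp 1 * y) ^ v * E"
    by (intro mult_right_mono) (auto simp: E_def)
  with P1 have "exp (real v) * E < 1" by linarith
  moreover have "exp (real v) * E = exp (real v - real n * \<eta> / 4)"
    unfolding E_def by (simp flip: exp_add)
  ultimately have "exp (real v - real n * \<eta> / 4) < exp 0" by (simp only: exp_zero)
  then have "real v < real n * \<eta> / 4" by (simp only: exp_less_cancel_iff diff_less_0_iff_less)
  then have "4 < y * \<eta>" using v0 by (simp add: y_def field_simps)
  \<comment> \<open>In the application \<open>c * R ^ d\<close> is a lower bound for the mass of a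
    ball, hence at most 1. Cancelling \<open>\<eta>\<close> then gives
    \<open>(R / s) ^ d \<le> y\<close>.\<close>
  moreover have "(R / s) ^ d * \<eta> \<le> 1" using c s by (simp add: \<eta> power_divide mult.commute)
  ultimately have "(R / s) ^ d * \<eta> \<le> y * \<eta>" by simp
  then have "(R / s) ^ d \<le> y" using c s by (simp add: \<eta>)
  also have "y \<le> 2 * exp 1 * y"
    using y exp_ge_add_one_self[of 1] mult_right_mono[of 1 "2 * exp 1" y] by simp
  finally have key: "((R / s) ^ d) ^ v \<le> (2 * exp 1 * y) ^ v"
    using R s by (intro power_mono) auto
  \<comment> \<open>\<open>R / s \<ge> 2\<close> and \<open>v \<ge> d + 2\<close> let
    \<open>2 * (d + 1)\<close> be absorbed in \<open>(R / s) ^ (v - 1)\<close>. The base of the net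
    size is then at most \<open>(R / s) ^ v\<close>, and exchanging the exponents \<open>d\<close>
    and \<open>v\<close> makes \<open>key\<close> applicable.\<close>
  have "real (Suc d) \<le> real (2 ^ d)" using less_exp[of d] by (simp only: of_nat_le_iff Suc_le_eq)
  then have "2 * (real d + 1) \<le> 2 * 2 ^ d" by simp
  also have "\<dots> = 2 ^ (d + 1)" by simp
  also have "\<dots> \<le> 2 ^ (v - 1)" using v by (intro power_increasing) auto
  also have "\<dots> \<le> (R / s) ^ (v - 1)" using s by (intro power_mono) (auto simp: field_simps)
  finally have "2 * R * (real d + 1) / s \<le> (R / s) * (R / s) ^ (v - 1)"
    using R s mult_left_mono[of "2 * (real d + 1)" "(R / s) ^ (v - 1)" "R / s"] by (simp add: mult.assoc mult.left_commute)
  also have "\<dots> = (R / s) ^ v" using v by (simp add: power_eq_if)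
  finally have "(2 * R * (real d + 1) / s) ^ d \<le> ((R / s) ^ v) ^ d"
    using R s by (intro power_mono) auto
  also have "\<dots> = ((R / s) ^ d) ^ v" by (simp add: power_mult[symmetric] mult.commute)
  also note key
  also have "(2 * exp 1 * y) ^ v \<le> 2 * (2 * exp 1 * y) ^ v" using y by simp
  finally have "(2 * R * (real d + 1) / s) ^ d * E \<le> 2 * (2 * exp 1 * y) ^ v * E"
    by (intro mult_right_mono) (auto simp: E_def)
  then show ?thesis using P1 unfolding Psi_eq E_def[symmetric] by simp
qed

text \<open>Every admissible \<open>w\<close> is within \<open>t * s\<close> of a net point
  \<open>u\<close>, and a sample point within \<open>(1 - t) * s\<close> of \<open>u\<close> is
  within \<open>s\<close> of \<open>w\<close>. So it suffices to hit finitely many balls, and the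
  union bound costs the size of the net.\<close>

lemma (in prob_space) uncovered_ball_event:
  fixes X :: "nat \<Rightarrow> 'a \<Rightarrow> 'b::euclidean_space"
  assumes ind: "indep_vars (\<lambda>_. borel) X {1..n}"
    and dist: "\<And>i. i \<in> {1..n} \<Longrightarrow> distr M borel (X i) = P"
    and P: "prob_space P" "P = density lborel (\<lambda>x. ennreal (f x))" and f: "f \<in> borel_measurable borel"
    and flo: "0 < flo" "\<And>x. norm x \<le> R \<Longrightarrow> flo \<le> f x"
    and s: "0 < s" "2 * s \<le> R" and v: "DIM('b) + 2 \<le> v" "v \<le> n"
    and \<eta>: "\<eta> = flo * unit_ball_vol (real DIM('b)) * s ^ DIM('b)"
  obtains E where "E \<in> events" "prob E \<le> Psi n \<eta> v"
    "\<And>\<omega> w. \<omega> \<in> space M - E \<Longrightarrow> norm w \<le> R - s \<Longrightarrow> \<exists>j\<in>{1..n}. dist w (X j \<omega>) < s"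
proof (cases "Psi n \<eta> v < 1")
  case False
  \<comment> \<open>The bound is 1 here, so the whole space serves as \<open>E\<close> and the
    covering claim is void.\<close>
  show ?thesis
    by (rule that[of "space M"]) (use False prob_space in auto)
next
  case True
  define d where "d = DIM('b)"
  \<comment> \<open>With this \<open>t\<close> the smaller balls keep at least a quarter of the
    volume, while the mesh \<open>t * s\<close> raises the bound on the net size by the factor
    \<open>(d + 1) ^ d\<close>.\<close>
  define t where "t = 1 / (real d + 1)"
  define V where "V = unit_ball_vol (real d)"
  have R: "R > 0" and V: "V > 0" and t: "0 < t" "t \<le> 1"
    using s by (auto simp: V_def t_def field_simps)
  have "flo * (V * R ^ d) \<le> measure P (cball 0 R)"
    using V R flo by (intro density_measure_bounds(1)[OF P f]) (auto simp: emeasure_cball V_def d_def)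
  also have "\<dots> \<le> 1" using P(1) by (rule prob_space.prob_le_1)
  finally have c: "flo * V * R ^ d \<le> 1" by (simp add: mult.assoc)
  have \<rho>: "R - s + t * s / 2 \<le> R" "t * s > 0"
    using t s mult_right_mono[of t 1 s] by auto
  obtain T :: "'b set" where T: "finite T" "T \<subseteq> cball 0 (R - s)"
    "\<And>w. w \<in> cball 0 (R - s) \<Longrightarrow> \<exists>u\<in>T. dist w u < t * s" "real (card T) \<le> (2 * R / (t * s)) ^ d"
    using finite_net_cball[OF \<rho>(2,1) R] unfolding d_def by metis
  define F where "F u = {\<omega>\<in>space M. \<forall>i\<in>{1..n}. X i \<omega> \<notin> ball u ((1 - t) * s)}" for u
  define E where "E = (\<Union>u\<in>T. F u)"
  have n: "1 \<le> n" using v by simp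
  have F: "F u \<in> events" "prob (F u) \<le> exp (- (real n * \<eta> / 4))" if u: "u \<in> T" for u
  proof -
    have "flo * (V * ((1 - t) * s) ^ d) \<le> measure P (ball u ((1 - t) * s))"
    proof (rule density_measure_bounds(1)[OF P f])
      show "emeasure lborel (ball u ((1 - t) * s)) = ennreal (V * ((1 - t) * s) ^ d)"
        using t s by (subst emeasure_ball) (auto simp: V_def d_def)
      fix y assume "y \<in> ball u ((1 - t) * s)"
      then have "norm (u - y) \<le> (1 - t) * s" by (simp add: dist_norm)
      moreover have "norm u \<le> R - s" using T u by auto
      moreover have "(1 - t) * s \<le> s" using t s by (simp add: mult_left_le_one_le)
      ultimately have "norm y \<le> R"
        using norm_triangle_sub[of y u] by (simp add: norm_minus_commute)
      then show "flo \<le> f y" by (rule flo)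
    qed (use flo V t s in auto)
    moreover have "\<eta> / 4 \<le> flo * (V * ((1 - t) * s) ^ d)"
    proof -
      have "\<eta> / 4 = flo * V * s ^ d * (1 / 4)" by (simp add: \<eta> V_def d_def)
      also have "\<dots> \<le> flo * V * s ^ d * (1 - t) ^ d"
        using shrunk_ratio_power_ge[of d] flo V s unfolding t_def
        by (intro mult_left_mono) auto
      finally show ?thesis by (simp add: power_mult_distrib mult_ac)
    qed
    ultimately have p: "\<eta> / 4 \<le> measure P (ball u ((1 - t) * s))" by linarith
    note no_hit = prob_no_hit_le[OF ind n dist _ p]
    show "F u \<in> events" unfolding F_def by (rule no_hit(1)) simp_all
    have "prob (F u) \<le> exp (- (real n * (\<eta> / 4)))" unfolding F_def by (rule no_hit(2)) simp_all
    then show "prob (F u) \<le> exp (- (real n * \<eta> / 4))" by (simp only: times_divide_eq_right)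
  qed
  have E: "E \<in> events" unfolding E_def using F T(1) by blast
  have "prob E \<le> (\<Sum>u\<in>T. prob (F u))"
    unfolding E_def using F T(1) by (intro finite_measure_subadditive_finite) auto
  also have "\<dots> \<le> real (card T) * exp (- (real n * \<eta> / 4))"
    using sum_bounded_above[of T "\<lambda>u. prob (F u)"] F(2) by simp
  also have "\<dots> \<le> (2 * R / (t * s)) ^ d * exp (- (real n * \<eta> / 4))"
    using T(4) by (intro mult_right_mono) auto
  also have "2 * R / (t * s) = 2 * R * (real d + 1) / s"
    by (simp add: t_def)
  also have "\<dots> ^ d * exp (- (real n * \<eta> / 4)) \<le> Psi n \<eta> v"
    using net_size_times_exp_le_Psi[OF v s _ _ _ True, of "flo * V"] flo V c
    by (simp add: \<eta> V_def d_def)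
  finally have "prob E \<le> Psi n \<eta> v" .
  moreover have "\<exists>j\<in>{1..n}. dist w (X j \<omega>) < s" if \<omega>: "\<omega> \<in> space M - E" and w: "norm w \<le> R - s" for \<omega> w
  proof -
    obtain u where u: "u \<in> T" "dist w u < t * s" using T(3)[of w] w by auto
    then obtain j where j: "j \<in> {1..n}" "dist u (X j \<omega>) < (1 - t) * s"
      using \<omega> by (auto simp: E_def F_def)
    have "dist w (X j \<omega>) < t * s + (1 - t) * s"
      using dist_triangle[of w "X j \<omega>" u] u j by linarith
    then show ?thesis using j by (auto simp: algebra_simps)
  qed
  ultimately show ?thesis using that E by blast
qed

section \<open>Bernstein bound for ball counts\<close>

text \<open>Multiplying by \<open>1 - t / 3\<close> avoids the restriction \<open>t < 3\<close>.\<close>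

lemma exp_minus_one_minus_self_le:
  fixes t :: real
  assumes "0 \<le> t"
  shows "(1 - t / 3) * (exp t - 1 - t) \<le> t\<^sup>2 / 2"
proof -
  \<comment> \<open>\<open>g'\<close> is the derivative of \<open>g\<close>, and both vanish at 0.
    The second derivative is nonpositive because \<open>1 - x \<le> exp (- x)\<close>.\<close>
  define g where "g u = (1 - u / 3) * (exp u - 1 - u) - u\<^sup>2 / 2" for u :: real
  define g' where "g' u = exp u * (2 / 3 - u / 3) - 2 / 3 - u / 3" for u :: real
  have g': "g' u \<le> 0" if "0 \<le> u" for u
  proof -
    have d: "(g' has_real_derivative exp x * (1 / 3 - x / 3) - 1 / 3) (at x)" for x
      unfolding g'_def by (auto intro!: derivative_eq_intros simp: algebra_simps)
    have "exp x * (1 / 3 - x / 3) - 1 / 3 \<le> 0" for x :: real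
    proof -
      have "exp x * (1 - x) \<le> exp x * exp (- x)"
        using exp_ge_add_one_self[of "- x"] by (intro mult_left_mono) auto
      then show ?thesis by (simp add: exp_minus algebra_simps)
    qed
    then have "g' u \<le> g' 0"
      using d by (intro DERIV_nonpos_imp_nonincreasing[OF that]) blast
    then show ?thesis by (simp add: g'_def)
  qed
  have "(g has_real_derivative g' x) (at x)" for x
    unfolding g_def g'_def by (auto intro!: derivative_eq_intros simp: field_simps)
  then have "g t \<le> g 0"
    using g' by (intro DERIV_nonpos_imp_nonincreasing[OF assms]) blast
  then show ?thesis by (simp add: g_def)
qed

text \<open>With \<open>D = \<mu> + t / 3\<close> the choice \<open>s = t / D\<close> gives
  \<open>1 - s / 3 = \<mu> / D\<close>, and the preceding inequality bounds the exponent by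
  \<open>- t^2 / (2 * D)\<close>. The two terms of \<open>t\<close> are what makes
  \<open>t^2 \<ge> 2 * L * D\<close>.\<close>

lemma bernstein_exponent:
  fixes \<mu> L :: real
  assumes \<mu>: "\<mu> > 0" and L: "L > 0"
  defines "t \<equiv> sqrt (2 * \<mu> * L) + 2 / 3 * L"
  obtains s where "s \<ge> 0" "\<mu> * (exp s - 1) - s * (\<mu> + t) \<le> - L"
proof -
  define D where "D = \<mu> + t / 3"
  define s where "s = t / D"
  have t: "t > 0" unfolding t_def using \<mu> L by (intro add_nonneg_pos) auto
  have D: "D > 0" using \<mu> t by (simp add: D_def)
  have s: "s \<ge> 0" using t D by (simp add: s_def)
  have tt: "t\<^sup>2 \<ge> 2 * L * D"
  proof -
    define w where "w = sqrt (2 * \<mu> * L)"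
    have w: "w\<^sup>2 = 2 * \<mu> * L" "w \<ge> 0" using \<mu> L by (auto simp: w_def)
    have "t\<^sup>2 = w\<^sup>2 + 4 / 3 * (L * w) + 4 / 9 * L\<^sup>2"
      unfolding t_def w_def[symmetric] by (simp add: power2_eq_square algebra_simps)
    moreover have "2 * L * D = 2 * \<mu> * L + 2 / 3 * (L * w) + 4 / 9 * L\<^sup>2"
      unfolding D_def t_def w_def[symmetric] by (simp add: power2_eq_square algebra_simps)
    moreover have "0 \<le> L * w" using L w by simp
    ultimately show ?thesis using w by linarith
  qed
  have "1 - s / 3 = \<mu> / D" using D by (simp add: s_def D_def field_simps)
  with exp_minus_one_minus_self_le[OF s]
  have "\<mu> / D * (exp s - 1 - s) \<le> s\<^sup>2 / 2" by simp
  then have "\<mu> * (exp s - 1 - s) \<le> D * (s\<^sup>2 / 2)"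
    using D by (simp add: field_simps)
  also have "D * (s\<^sup>2 / 2) = t\<^sup>2 / (2 * D)"
    using D by (simp add: s_def power2_eq_square field_simps)
  finally have "\<mu> * (exp s - 1) - s * (\<mu> + t) \<le> t\<^sup>2 / (2 * D) - s * t"
    by (simp add: algebra_simps)
  also have "s * t = 2 * (t\<^sup>2 / (2 * D))"
    using D by (simp add: s_def power2_eq_square)
  also have "t\<^sup>2 / (2 * D) - 2 * (t\<^sup>2 / (2 * D)) = - (t\<^sup>2 / (2 * D))" by simp
  also have "\<dots> \<le> - L" using tt D by (simp add: field_simps)
  finally show ?thesis using that s by blast
qed

text \<open>Given the \<open>i\<close>-th point, the others are independent and the integral of the
  product factorises. Each factor is \<open>1 + (exp s - 1) * measure P (cball y r)\<close>, at most
  \<open>exp (p * (exp s - 1))\<close> whatever \<open>y\<close> is, as for a Poisson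
  variable.\<close>

lemma nn_integral_ball_count_le:
  fixes P :: "'a::euclidean_space measure"
  assumes P: "prob_space P" and sets_P [measurable_cong]: "sets P = sets borel"
    and J: "finite J" "i \<notin> J" and p: "\<And>y. measure P (cball y r) \<le> p" and s: "0 \<le> s"
  shows "(\<integral>\<^sup>+x. (\<Prod>j\<in>J. if dist (x i) (x j) \<le> r then ennreal (exp s) else 1)
            \<partial>Pi\<^sub>M (insert i J) (\<lambda>_. P)) \<le> ennreal (exp (real (card J) * (p * (exp s - 1))))"
proof -
  interpret P: prob_space P by (rule P)
  interpret PP: product_prob_space "\<lambda>_. P" "insert i J" by standard
  have inner: "(\<integral>\<^sup>+y'. (if dist y y' \<le> r then ennreal (exp s) else 1) \<partial>P) \<le> ennreal (exp (p * (exp s - 1)))" for y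
  proof -
    have e: "ennreal (exp s) = 1 + ennreal (exp s - 1)"
      using s ennreal_plus[of 1 "exp s - 1"] by simp
    have "(\<integral>\<^sup>+y'. (if dist y y' \<le> r then ennreal (exp s) else 1) \<partial>P)
        = (\<integral>\<^sup>+y'. 1 + ennreal (exp s - 1) * indicator (cball y r) y' \<partial>P)"
      by (intro nn_integral_cong) (simp add: indicator_def e)
    also have "\<dots> = 1 + ennreal (exp s - 1) * emeasure P (cball y r)"
    proof (subst nn_integral_add)
      show "(\<lambda>y'. ennreal (exp s - 1) * indicator (cball y r) y') \<in> borel_measurable P"
        by (intro borel_measurable_times_ennreal borel_measurable_indicator) (simp_all add: sets_P)
    qed (simp_all add: nn_integral_cmult_indicator P.emeasure_space_1 sets_P)
    also have "\<dots> = ennreal (1 + (exp s - 1) * measure P (cball y r))"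
      using s by (simp add: P.emeasure_eq_measure ennreal_mult)
    also have "\<dots> \<le> ennreal (exp (p * (exp s - 1)))"
    proof (rule ennreal_leI)
      have "(exp s - 1) * measure P (cball y r) \<le> p * (exp s - 1)"
        using p[of y] s by (subst mult.commute) (intro mult_right_mono, auto)
      then show "1 + (exp s - 1) * measure P (cball y r) \<le> exp (p * (exp s - 1))"
        using exp_ge_add_one_self[of "p * (exp s - 1)"] by linarith
    qed
    finally show ?thesis .
  qed
  have "(\<integral>\<^sup>+x. (\<Prod>j\<in>J. if dist (x i) (x j) \<le> r then ennreal (exp s) else 1) \<partial>Pi\<^sub>M (insert i J) (\<lambda>_. P))
     = (\<integral>\<^sup>+y. (\<integral>\<^sup>+x. (\<Prod>j\<in>J. if dist ((x(i := y)) i) ((x(i := y)) j) \<le> r then ennreal (exp s) else 1)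
           \<partial>Pi\<^sub>M J (\<lambda>_. P)) \<partial>P)"
    by (rule PP.product_nn_integral_insert_rev[OF J]) measurable
  also have "\<dots> = (\<integral>\<^sup>+y. (\<integral>\<^sup>+x. (\<Prod>j\<in>J. if dist y (x j) \<le> r then ennreal (exp s) else 1)
           \<partial>Pi\<^sub>M J (\<lambda>_. P)) \<partial>P)"
    using J by (intro nn_integral_cong prod.cong) auto
  also have "\<dots> = (\<integral>\<^sup>+y. (\<Prod>j\<in>J. \<integral>\<^sup>+y'. (if dist y y' \<le> r then ennreal (exp s) else 1) \<partial>P) \<partial>P)"
    using J by (intro nn_integral_cong PP.product_nn_integral_prod) auto
  also have "\<dots> \<le> (\<integral>\<^sup>+y. (\<Prod>j\<in>J. ennreal (exp (p * (exp s - 1)))) \<partial>P)"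
    using inner by (intro nn_integral_mono prod_mono_ennreal)
  also have "\<dots> = ennreal (exp (real (card J) * (p * (exp s - 1))))"
    by (simp add: P.emeasure_space_1 exp_of_nat_mult ennreal_power)
  finally show ?thesis .
qed

text \<open>Chernoff bound: Markov's inequality for \<open>exp (s * N)\<close>, where
  \<open>N\<close> counts the points in the ball. The joint law of the sample is a product measure,
  so the preceding lemma bounds the expectation.\<close>

lemma (in prob_space) ball_count_tail:
  fixes X :: "nat \<Rightarrow> 'a \<Rightarrow> 'b::euclidean_space"
  assumes ind: "indep_vars (\<lambda>_. borel) X {1..n}" and i: "i \<in> {1..n}"
    and dist: "\<And>i. i \<in> {1..n} \<Longrightarrow> distr M borel (X i) = P"
    and p: "\<And>y. measure P (cball y r) \<le> p" and s: "0 \<le> s"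
  shows "{\<omega>\<in>space M. T \<le> real (card {j \<in> {1..n} - {i}. dist (X i \<omega>) (X j \<omega>) \<le> r})} \<in> events"
    and "prob {\<omega>\<in>space M. T \<le> real (card {j \<in> {1..n} - {i}. dist (X i \<omega>) (X j \<omega>) \<le> r})}
       \<le> exp ((real n - 1) * p * (exp s - 1) - s * T)"
proof -
  have X [measurable]: "X i \<in> M \<rightarrow>\<^sub>M borel" if "i \<in> {1..n}" for i
    using ind that by (auto simp: indep_vars_def)
  define J where "J = {1..n} - {i}"
  have J: "finite J" "i \<notin> J" "insert i J = {1..n}" "real (card J) = real n - 1"
    using i by (auto simp: J_def of_nat_diff)
  have Xj [measurable]: "X j \<in> M \<rightarrow>\<^sub>M borel" if "j \<in> J" for j
    using that by (auto simp: J_def)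
  note Xi [measurable] = X[OF i]
  have P: "prob_space P" "sets P = sets borel"
    using prob_space_distr[OF Xi] dist[OF i] by auto
  define N where "N \<omega> = card {j \<in> J. dist (X i \<omega>) (X j \<omega>) \<le> r}" for \<omega>
  define G :: "'a \<Rightarrow> ennreal" where
    "G \<omega> = (\<Prod>j\<in>J. if dist (X i \<omega>) (X j \<omega>) \<le> r then ennreal (exp s) else 1)" for \<omega>
  have N: "N \<omega> = (\<Sum>j\<in>J. if dist (X i \<omega>) (X j \<omega>) \<le> r then 1 else 0)" for \<omega>
    using J(1) by (simp add: N_def sum.If_cases Int_def)
  have [measurable]: "N \<in> M \<rightarrow>\<^sub>M count_space UNIV"
    unfolding N by measurable
  show "{\<omega>\<in>space M. T \<le> real (card {j \<in> {1..n} - {i}. dist (X i \<omega>) (X j \<omega>) \<le> r})} \<in> events"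
    unfolding J_def[symmetric] N_def[symmetric] by measurable
  have G: "G \<omega> = ennreal (exp (s * real (N \<omega>)))" for \<omega>
    using J(1) by (simp add: G_def N_def prod.If_cases Int_def ennreal_power mult.commute[of s] exp_of_nat_mult)
  have [measurable]: "G \<in> borel_measurable M" unfolding G_def by measurable
  have "(\<integral>\<^sup>+\<omega>. G \<omega> \<partial>M) = (\<integral>\<^sup>+x. (\<Prod>j\<in>J. if dist (x i) (x j) \<le> r then ennreal (exp s) else 1)
            \<partial>distr M (Pi\<^sub>M {1..n} (\<lambda>_. borel)) (\<lambda>\<omega>. \<lambda>i\<in>{1..n}. X i \<omega>))"
    (is "_ = (\<integral>\<^sup>+x. ?h x \<partial>distr M ?B ?Y)")
  proof -
    have "(\<integral>\<^sup>+x. ?h x \<partial>distr M ?B ?Y) = (\<integral>\<^sup>+\<omega>. ?h (?Y \<omega>) \<partial>M)"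
    proof (rule nn_integral_distr)
      show "?Y \<in> M \<rightarrow>\<^sub>M ?B" by (rule measurable_restrict) (rule X)
      show "?h \<in> borel_measurable (distr M ?B ?Y)"
        unfolding J(3)[symmetric] measurable_distr_eq1 by measurable
    qed
    also have "\<dots> = (\<integral>\<^sup>+\<omega>. G \<omega> \<partial>M)"
      unfolding G_def using i by (intro nn_integral_cong prod.cong) (auto simp: J_def)
    finally show ?thesis ..
  qed
  also have "distr M ?B ?Y = Pi\<^sub>M {1..n} (\<lambda>i. distr M borel (X i))"
    using ind i by (subst (asm) indep_vars_iff_distr_eq_PiM') (use X in auto)
  also have "\<dots> = Pi\<^sub>M (insert i J) (\<lambda>_. P)"
    unfolding J(3) using dist by (intro PiM_cong) auto
  also have "(\<integral>\<^sup>+x. ?h x \<partial>\<dots>) \<le> ennreal (exp (real (card J) * (p * (exp s - 1))))"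
    by (rule nn_integral_ball_count_le[OF P J(1,2) p s])
  finally have mgf: "(\<integral>\<^sup>+\<omega>. G \<omega> \<partial>M) \<le> ennreal (exp ((real n - 1) * p * (exp s - 1)))"
    unfolding J(4) by (simp add: mult.assoc)
  have "emeasure M {\<omega>\<in>space M. T \<le> real (N \<omega>)}
      \<le> emeasure M ({\<omega>\<in>space M. 1 \<le> ennreal (exp (- (s * T))) * G \<omega>})"
  proof (rule emeasure_mono)
    show "{\<omega>\<in>space M. T \<le> real (N \<omega>)} \<subseteq> {\<omega>\<in>space M. 1 \<le> ennreal (exp (- (s * T))) * G \<omega>}"
    proof safe
      fix \<omega> assume "T \<le> real (N \<omega>)"
      then have "s * T \<le> s * real (N \<omega>)" using s by (rule mult_left_mono)
      then have "1 \<le> exp (- (s * T)) * exp (s * real (N \<omega>))" by (simp flip: exp_add)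
      then show "1 \<le> ennreal (exp (- (s * T))) * G \<omega>"
        unfolding G by (simp flip: ennreal_mult ennreal_1)
    qed
  qed measurable
  also have "\<dots> \<le> ennreal (exp (- (s * T))) * (\<integral>\<^sup>+\<omega>. G \<omega> * indicator (space M) \<omega> \<partial>M)"
    by (rule nn_integral_Markov_inequality) auto
  also have "(\<integral>\<^sup>+\<omega>. G \<omega> * indicator (space M) \<omega> \<partial>M) = (\<integral>\<^sup>+\<omega>. G \<omega> \<partial>M)"
    by (intro nn_integral_cong) simp
  also have "ennreal (exp (- (s * T))) * \<dots>
      \<le> ennreal (exp (- (s * T))) * ennreal (exp ((real n - 1) * p * (exp s - 1)))"
    by (intro mult_left_mono mgf) simp
  also have "\<dots> = ennreal (exp ((real n - 1) * p * (exp s - 1) - s * T))"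
    by (simp flip: ennreal_mult exp_add)
  finally have "prob {\<omega>\<in>space M. T \<le> real (N \<omega>)} \<le> exp ((real n - 1) * p * (exp s - 1) - s * T)"
    by (simp add: emeasure_eq_measure)
  then show "prob {\<omega>\<in>space M. T \<le> real (card {j \<in> {1..n} - {i}. dist (X i \<omega>) (X j \<omega>) \<le> r})}
       \<le> exp ((real n - 1) * p * (exp s - 1) - s * T)"
    by (simp add: N_def J_def)
qed

text \<open>Taking \<open>L = ln (n / \<delta>)\<close> makes each of the \<open>n\<close> tails at
  most \<open>\<delta> / n\<close>, and the union bound adds them up to
  \<open>\<delta>\<close>.\<close>

lemma (in prob_space) crowded_ball_event:
  fixes X :: "nat \<Rightarrow> 'a \<Rightarrow> 'b::euclidean_space"
  assumes ind: "indep_vars (\<lambda>_. borel) X {1..n}" and n: "2 \<le> n"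
    and dist: "\<And>i. i \<in> {1..n} \<Longrightarrow> distr M borel (X i) = P"
    and p: "\<And>y. measure P (cball y r) \<le> p" "0 < p" and \<delta>: "0 < \<delta>" "\<delta> < 1"
  defines "\<mu> \<equiv> (real n - 1) * p"
  defines "T \<equiv> \<mu> + sqrt (2 * \<mu> * ln (real n / \<delta>)) + 2 / 3 * ln (real n / \<delta>)"
  defines "E \<equiv> {\<omega>\<in>space M. \<exists>i\<in>{1..n}. T \<le> real (card {j \<in> {1..n} - {i}. dist (X i \<omega>) (X j \<omega>) \<le> r})}"
  shows "E \<in> events" "prob E \<le> \<delta>"
proof -
  define L where "L = ln (real n / \<delta>)"
  have "real n / \<delta> > 1" using n \<delta> by (simp add: field_simps)
  then have L: "L > 0" "exp (- L) = \<delta> / real n" by (auto simp: L_def exp_minus)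
  have \<mu>: "\<mu> > 0" using n p by (simp add: \<mu>_def)
  obtain s where s: "s \<ge> 0" "\<mu> * (exp s - 1) - s * (\<mu> + (sqrt (2 * \<mu> * L) + 2 / 3 * L)) \<le> - L"
    using bernstein_exponent[OF \<mu> L(1)] by blast
  let ?E = "\<lambda>i. {\<omega>\<in>space M. T \<le> real (card {j \<in> {1..n} - {i}. dist (X i \<omega>) (X j \<omega>) \<le> r})}"
  have E: "E = (\<Union>i\<in>{1..n}. ?E i)" by (auto simp: E_def)
  have meas: "?E i \<in> events" if "i \<in> {1..n}" for i
    by (rule ball_count_tail(1)[OF ind that dist p(1) s(1)])
  show "E \<in> events" unfolding E by (rule sets.finite_UN[OF finite_atLeastAtMost meas])
  have "prob (?E i) \<le> \<delta> / real n" if "i \<in> {1..n}" for i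
  proof -
    have "prob (?E i) \<le> exp (\<mu> * (exp s - 1) - s * T)"
      unfolding \<mu>_def by (rule ball_count_tail(2)[OF ind that dist p(1) s(1)])
    also have "\<dots> \<le> exp (- L)" using s(2) by (simp add: T_def L_def add.assoc)
    finally show ?thesis by (simp add: L)
  qed
  then have "(\<Sum>i\<in>{1..n}. prob (?E i)) \<le> real (card {1..n}) * (\<delta> / real n)"
    by (intro sum_bounded_above) auto
  moreover have "prob E \<le> (\<Sum>i\<in>{1..n}. prob (?E i))"
    unfolding E by (rule finite_measure_subadditive_finite[OF finite_atLeastAtMost]) (use meas in blast)
  ultimately show "prob E \<le> \<delta>" using n by simp
qed

section \<open>Proof of the theorem\<close>

text \<open>A point is no farther from the nearest mean than from the mean of its own block, so up
  to the factor \<open>1 / n\<close> the risk of the means is at most the optimal cost, which no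
  tuple \<open>c'\<close> can beat.\<close>

lemma partition_centres:
  fixes x :: "nat \<Rightarrow> 'a::euclidean_space"
  assumes opt: "opt_partition n x K l" and K: "1 \<le> K" "K \<le> n"
    and b: "bij_betw b {1..K} l"
  defines "c \<equiv> restrict (\<lambda>k. mean_point x (b k)) {1..K}"
  shows "emp_risk n x K c \<le> emp_risk n x K c'"
proof -
  have l: "partition_on {1..n} l" using opt by (simp add: opt_partition_iff)
  have "(\<Sum>i=1..n. dist_to_centres K c (x i)) = (\<Sum>A\<in>l. \<Sum>i\<in>A. dist_to_centres K c (x i))"
    using sum.partition[OF finite_atLeastAtMost l] by simp
  also have "\<dots> \<le> (\<Sum>A\<in>l. phi_SSE x A)"
    unfolding phi_SSE_def
  proof (intro sum_mono)
    fix A i assume "A \<in> l" "i \<in> A"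
    then obtain k where k: "k \<in> {1..K}" "b k = A" using b by (auto simp: bij_betw_def)
    then show "dist_to_centres K c (x i) \<le> (norm (x i - mean_point x A))\<^sup>2"
      using dist_to_centres_le[OF K(1) k(1), of c "x i"] by (simp add: c_def)
  qed
  also have "\<dots> \<le> (\<Sum>i=1..n. dist_to_centres K c' (x i))"
    by (rule opt_partition_le_centres[OF opt K])
  finally show ?thesis
    unfolding emp_risk_def by (intro mult_left_mono) auto
qed

text \<open>The deterministic part: the good events enter as \<open>xR\<close>, \<open>gap\<close>,
  \<open>cov\<close> and \<open>edge\<close>. The block means have least empirical risk, hence are
  near an optimal tuple, and so have the separation and margin that
  \<open>optimal_block_connected\<close> asks for.\<close>

lemma OPT_le_OPT_unc_if_good_sample:
  fixes x :: "nat \<Rightarrow> 'a::euclidean_space" and P :: "'a measure"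
  assumes P: "prob_space P" "sets P = sets borel" "integrable P (\<lambda>x. (norm x)\<^sup>2)"
    and ne: "opt_centres P K R \<noteq> {}"
    and K: "1 \<le> K" "K \<le> n" and R: "R > 0" and a: "0 < a_zero P K R \<epsilon>"
    and r: "0 < r" "r \<le> 4 * (2 * R + a_zero P K R \<epsilon>)"
    and xR: "\<And>i. i \<in> {1..n} \<Longrightarrow> norm (x i) \<le> R"
    and gap: "\<not> risk_gap P K R \<epsilon> \<le> ereal (2 * unif_dev n x P K R)"
    and cov: "\<And>w. norm w \<le> R - r / 4 * (a_zero P K R \<epsilon> / (2 * R + a_zero P K R \<epsilon>)) \<Longrightarrow>
                \<exists>j\<in>{1..n}. dist w (x j) < r / 4 * (a_zero P K R \<epsilon> / (2 * R + a_zero P K R \<epsilon>))"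
    and edge: "\<And>i j. i \<in> {1..n} \<Longrightarrow> j \<in> {1..n} \<Longrightarrow> i \<noteq> j \<Longrightarrow> dist (x i) (x j) \<le> r \<Longrightarrow> {i, j} \<in> E"
  shows "OPT n x E K \<le> OPT_unc n x K"
proof -
  obtain l where opt: "opt_partition n x K l" using opt_partition_exists[OF K] .
  have l: "partition_on {1..n} l" "card l = K" using opt by (auto simp: opt_partition_iff)
  have fl: "finite l" using l finite_elements by blast
  obtain b where b: "bij_betw b {1..K} l"
    using finite_same_card_bij[of "{1..K}" l] fl l(2) by auto
  define c where "c = restrict (\<lambda>k. mean_point x (b k)) {1..K}"
  have cR: "c \<in> centre_set K R"
    unfolding centre_set_def c_def
  proof (intro restrict_PiE_iff[THEN iffD2] ballI)
    fix k assume "k \<in> {1..K}"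
    then have A: "b k \<in> l" using b by (auto simp: bij_betw_def)
    then have "b k \<subseteq> {1..n}" "b k \<noteq> {}" using l(1) by (auto simp: partition_on_def)
    then have "norm (mean_point x (b k)) \<le> R"
      using finite_subset[of "b k" "{1..n}"] xR by (intro norm_mean_point_le) auto
    then show "mean_point x (b k) \<in> cball 0 R" by simp
  qed
  have emp: "emp_risk n x K c \<le> emp_risk n x K c'" for c'
    unfolding c_def by (rule partition_centres[OF opt K b])
  obtain c' where c': "c' \<in> opt_centres P K R" "d_inf K c c' < \<epsilon>"
    using near_optimal_centres[OF K(1) P R cR ne emp gap] by blast
  show ?thesis
  proof (rule OPT_le_OPT_unc[OF opt])
    fix A assume A: "A \<in> l"
    obtain k where k: "k \<in> {1..K}" "b k = A" using A b by (auto simp: bij_betw_def)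
    show "induces_connected E A"
    proof (rule optimal_block_connected[OF opt A xR _ _ a r R cov edge])
      show "norm (mean_point x A) \<le> R - a_zero P K R \<epsilon>"
        using centres_margin[OF K(1) P R c' k(1)] k by (simp add: c_def)
      fix B assume B: "B \<in> l" "B \<noteq> A"
      obtain k' where k': "k' \<in> {1..K}" "b k' = B"
        using B(1) bij_betw_imp_surj_on[OF b] by blast
      then have "k \<noteq> k'" using B k by auto
      from centres_separated[OF K(1) P R c' k(1) k'(1) this]
      show "2 * a_zero P K R \<epsilon> \<le> norm (mean_point x A - mean_point x B)"
        using k k' by (simp add: c_def)
    qed
  qed
qed

text \<open>The logarithm is at least 1, so \<open>V_const\<close> is at least
  \<open>2 * K * (d + 1)\<close>. The first bound serves the net comparison; the second gives
  \<open>K \<le> n\<close>, so that partitions into \<open>K\<close> blocks exist.\<close>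

lemma V_const_bounds:
  assumes "2 \<le> K"
  shows "d + 2 \<le> V_const d K" "K \<le> V_const d K"
proof -
  define z where "z = 2 * real K * (real d + 1)"
  have "2 \<le> exp 1 * real K * 2"
    using assms exp_ge_add_one_self[of 1] mult_mono[of 1 "exp 1" 1 "real K"] by simp
  then have "1 \<le> log 2 (2 * exp 1 * real K)"
    by (subst le_log_iff) (auto simp: mult_ac)
  then have "z * 1 \<le> z * log 2 (2 * exp 1 * real K)"
    by (intro mult_left_mono) (simp_all add: z_def)
  then have *: "z \<le> real (V_const d K)"
    unfolding V_const_def z_def by linarith
  have "real d + 2 \<le> 4 * (real d + 1)" by simp
  also have "\<dots> \<le> z" using assms unfolding z_def by (intro mult_right_mono) auto
  finally have "real (d + 2) \<le> real (V_const d K)" using * by simp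
  then show "d + 2 \<le> V_const d K" by (simp only: of_nat_le_iff)
  have "real K * 1 \<le> 2 * real K * (real d + 1)" by (intro mult_mono) auto
  then have "real K \<le> real (V_const d K)" using * by (simp add: z_def)
  then show "K \<le> V_const d K" by simp
qed

lemma (in prob_space) tail_event:
  fixes X :: "nat \<Rightarrow> 'a \<Rightarrow> 'b::euclidean_space"
  assumes ind: "indep_vars (\<lambda>_. borel) X {1..n}"
    and dist: "\<And>i. i \<in> {1..n} \<Longrightarrow> distr M borel (X i) = P"
  shows "{\<omega>\<in>space M. \<exists>i\<in>{1..n}. norm (X i \<omega>) > R} \<in> events"
    "prob {\<omega>\<in>space M. \<exists>i\<in>{1..n}. norm (X i \<omega>) > R} \<le> real n * tail_mass P R"
proof -
  have X [measurable]: "X i \<in> M \<rightarrow>\<^sub>M borel" if "i \<in> {1..n}" for i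
    using ind that by (auto simp: indep_vars_def)
  show "{\<omega>\<in>space M. \<exists>i\<in>{1..n}. norm (X i \<omega>) > R} \<in> events" by measurable
  let ?E = "\<lambda>i. {\<omega>\<in>space M. norm (X i \<omega>) > R}"
  have meas: "?E i \<in> events" if "i \<in> {1..n}" for i
    using X[OF that] by measurable
  have eq: "prob (?E i) = tail_mass P R" if i: "i \<in> {1..n}" for i
  proof -
    have "tail_mass P R = measure (distr M borel (X i)) {x. norm x > R}"
      using dist[OF i] by (simp add: tail_mass_def)
    also have "\<dots> = prob (X i -` {x. norm x > R} \<inter> space M)"
      using X[OF i] by (subst measure_distr) auto
    also have "X i -` {x. norm x > R} \<inter> space M = ?E i" by auto
    finally show ?thesis ..
  qed
  have "{\<omega>\<in>space M. \<exists>i\<in>{1..n}. norm (X i \<omega>) > R} = (\<Union>i\<in>{1..n}. ?E i)" by auto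
  also have "prob \<dots> \<le> (\<Sum>i\<in>{1..n}. prob (?E i))"
    by (rule finite_measure_subadditive_finite[OF finite_atLeastAtMost]) (use meas in blast)
  also have "\<dots> = real n * tail_mass P R" by (simp add: eq)
  finally show "prob {\<omega>\<in>space M. \<exists>i\<in>{1..n}. norm (X i \<omega>) > R} \<le> real n * tail_mass P R" .
qed

theorem theorem2:
  fixes M :: "'w measure"
    and P :: "'a::euclidean_space measure"
    and X :: "nat \<Rightarrow> 'w \<Rightarrow> 'a"
    and f :: "'a \<Rightarrow> real"
    and H :: "'w \<Rightarrow> nat set set"
    and n K q :: nat
    and R flo fhi \<epsilon>\<^sub>0 r \<delta> :: real
  assumes "prob_space M" and "prob_space P"
    and "prob_space.indep_vars M (\<lambda>_. borel) X {1..n}"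
    and "\<And>i. i \<in> {1..n} \<Longrightarrow> distr M borel (X i) = P"
    and "K \<ge> 2" and "R > 0"
    and "regular_density P K R f flo fhi"
    and "0 < \<epsilon>\<^sub>0" and "\<epsilon>\<^sub>0 < min (centre_sep P K R / 4) (centre_margin P K R / 2)"
    and "n \<ge> V_const DIM('a) K"
    and "0 < r" and "r \<le> 4 * (2 * R + a_zero P K R \<epsilon>\<^sub>0)"
    and "0 < \<delta>" and "\<delta> < 1"
    and "q \<ge> q_threshold DIM('a) n fhi r \<delta>"
    and "H \<in> M \<rightarrow>\<^sub>M count_space {E. simple_graph n E}"
    and "\<And>\<omega>. \<omega> \<in> space M \<Longrightarrow> nn_graph n (\<lambda>i. X i \<omega>) q \<subseteq> H \<omega>"
  shows "measure M {\<omega> \<in> space M.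
             OPT n (\<lambda>i. X i \<omega>) (H \<omega>) K > OPT_unc n (\<lambda>i. X i \<omega>) K}
         \<le> zeta M n X P K R \<epsilon>\<^sub>0 + real n * tail_mass P R
           + Psi n (eta P K R \<epsilon>\<^sub>0 flo r) (V_const DIM('a) K) + \<delta>"
proof -
  interpret prob_space M by fact
  define a where "a = a_zero P K R \<epsilon>\<^sub>0"
  define s where "s = r / 4 * (a / (2 * R + a))"
  define p where "p = fhi * (unit_ball_vol (real DIM('a)) * r ^ DIM('a))"
  note ind = assms(3) and dist = assms(4) and R = assms(6)
  have reg: "integrable P (\<lambda>x. (norm x)\<^sup>2)" "f \<in> borel_measurable borel"
    "P = density lborel (\<lambda>x. ennreal (f x))" "0 < flo" "\<And>x. norm x \<le> R \<Longrightarrow> flo \<le> f x"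
    "\<And>x. f x \<le> fhi" "opt_centres P K R \<noteq> {}"
    using assms(7) unfolding regular_density_def by blast+
  have sets_P: "sets P = sets borel" by (subst reg(3)) simp
  have K: "1 \<le> K" "2 \<le> K" "K \<le> n"
    using assms(5,10) V_const_bounds(2)[of K "DIM('a)"] by auto
  have n: "2 \<le> n" using K by simp
  have X: "X i \<in> M \<rightarrow>\<^sub>M borel" if "i \<in> {1..n}" for i
    using ind that by (auto simp: indep_vars_def)
  have a: "0 < a" "a \<le> R / 2"
    using a_zero_pos[OF assms(8,9)] a_zero_le_half[OF K(1) assms(2) sets_P reg(1) R reg(7) K(2) assms(8)]
    by (simp_all add: a_def)
  \<comment> \<open>The upper bound on \<open>r\<close> gives \<open>s \<le> a\<close>, and
    \<open>a\<close> is at most \<open>R / 2\<close>.\<close>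
  have "r / 4 * (a / (2 * R + a)) \<le> (2 * R + a) * (a / (2 * R + a))"
    using assms(12) a R by (intro mult_right_mono) (auto simp: a_def[symmetric])
  then have s: "0 < s" "2 * s \<le> R" using a R assms(11) by (auto simp: s_def)
  \<comment> \<open>So \<open>eta\<close> is the lower density bound times the volume of a ball of
    radius \<open>s\<close>.\<close>
  have eta: "eta P K R \<epsilon>\<^sub>0 flo r = flo * unit_ball_vol (real DIM('a)) * s ^ DIM('a)"
    unfolding eta_def theta_zero_def s_def a_def power_mult_distrib by (simp only: mult_ac)
  define E0 where "E0 = {\<omega>\<in>space M. risk_gap P K R \<epsilon>\<^sub>0 \<le> ereal (2 * unif_dev n (\<lambda>i. X i \<omega>) P K R)}"
  have [measurable]: "(\<lambda>\<omega>. unif_dev n (\<lambda>i. X i \<omega>) P K R) \<in> borel_measurable M"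
    by (rule borel_measurable_unif_dev[OF K(1) assms(2) sets_P reg(1) R X])
  have E0: "E0 \<in> events" "prob E0 = zeta M n X P K R \<epsilon>\<^sub>0"
    unfolding E0_def zeta_def by measurable
  define E1 where "E1 = {\<omega>\<in>space M. \<exists>i\<in>{1..n}. norm (X i \<omega>) > R}"
  have E1: "E1 \<in> events" "prob E1 \<le> real n * tail_mass P R"
    unfolding E1_def by (rule tail_event[OF ind dist], assumption)+
  obtain E2 where E2: "E2 \<in> events" "prob E2 \<le> Psi n (eta P K R \<epsilon>\<^sub>0 flo r) (V_const DIM('a) K)"
    "\<And>\<omega> w. \<omega> \<in> space M - E2 \<Longrightarrow> norm w \<le> R - s \<Longrightarrow> \<exists>j\<in>{1..n}. dist w (X j \<omega>) < s"
    using uncovered_ball_event[OF ind dist assms(2) reg(3,2,4,5) s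
        V_const_bounds(1)[OF K(2)] assms(10) eta] by blast
  have p0: "0 < fhi" using reg(4) reg(5)[of 0] reg(6)[of 0] R by simp
  have p: "measure P (cball y r) \<le> p" for y
    unfolding p_def using p0 reg(6) assms(11)
    by (intro density_measure_bounds(2)[OF assms(2) reg(3,2)]) (auto simp: emeasure_cball)
  have "0 < p" using p0 assms(11) by (simp add: p_def)
  define T where "T = (real n - 1) * p + sqrt (2 * ((real n - 1) * p) * ln (real n / \<delta>)) + 2 / 3 * ln (real n / \<delta>)"
  define E3 where "E3 = {\<omega>\<in>space M. \<exists>i\<in>{1..n}. T \<le> real (card {j \<in> {1..n} - {i}. dist (X i \<omega>) (X j \<omega>) \<le> r})}"
  have E3: "E3 \<in> events" "prob E3 \<le> \<delta>"
    unfolding E3_def T_def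
    by (rule crowded_ball_event[OF ind n dist p \<open>0 < p\<close> assms(13,14)], assumption)+
  have T: "mu_bar DIM('a) n fhi r = (real n - 1) * p" by (simp add: mu_bar_def p_def)
  \<comment> \<open>The two cases of the minimum in \<open>q_threshold\<close>: either
    \<open>q\<close> is at least the largest possible rank, or off \<open>E3\<close> no ball around
    a sample point holds more than \<open>q\<close> others.\<close>
  have q: "n - 1 \<le> q \<or> T \<le> real q"
    using assms(15) unfolding q_threshold_def T T_def by linarith
  have "OPT n (\<lambda>i. X i \<omega>) (H \<omega>) K \<le> OPT_unc n (\<lambda>i. X i \<omega>) K"
    if \<omega>: "\<omega> \<in> space M" "\<omega> \<notin> E0" "\<omega> \<notin> E1" "\<omega> \<notin> E2" "\<omega> \<notin> E3" for \<omega>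
  proof (rule OPT_le_OPT_unc_if_good_sample[OF assms(2) sets_P reg(1,7) K(1,3) R _ assms(11,12)])
    show "0 < a_zero P K R \<epsilon>\<^sub>0" using a by (simp add: a_def)
    show "norm (X i \<omega>) \<le> R" if "i \<in> {1..n}" for i
      using \<omega> that by (auto simp: E1_def not_less)
    show "\<not> risk_gap P K R \<epsilon>\<^sub>0 \<le> ereal (2 * unif_dev n (\<lambda>i. X i \<omega>) P K R)"
      using \<omega> by (simp add: E0_def)
    show "\<exists>j\<in>{1..n}. dist w (X j \<omega>) < r / 4 * (a_zero P K R \<epsilon>\<^sub>0 / (2 * R + a_zero P K R \<epsilon>\<^sub>0))"
      if "norm w \<le> R - r / 4 * (a_zero P K R \<epsilon>\<^sub>0 / (2 * R + a_zero P K R \<epsilon>\<^sub>0))" for w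
      using E2(3)[of \<omega> w] \<omega> that by (simp add: s_def a_def)
    show "{i, j} \<in> H \<omega>" if ij: "i \<in> {1..n}" "j \<in> {1..n}" "i \<noteq> j" "dist (X i \<omega>) (X j \<omega>) \<le> r" for i j
    proof -
      have "real (card {j \<in> {1..n} - {i}. dist (X i \<omega>) (X j \<omega>) \<le> r}) < T"
        using \<omega> ij(1) unfolding E3_def by (simp add: not_le)
      then have "n - 1 \<le> q \<or> card {j \<in> {1..n} - {i}. dist (X i \<omega>) (X j \<omega>) \<le> r} \<le> q"
        using q by linarith
      from nn_graph_edge[OF ij this] show ?thesis
        using assms(17)[OF \<omega>(1)] by blast
    qed
  qed
  then have "{\<omega> \<in> space M. OPT n (\<lambda>i. X i \<omega>) (H \<omega>) K > OPT_unc n (\<lambda>i. X i \<omega>) K} \<subseteq> E0 \<union> E1 \<union> E2 \<union> E3"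
    by (auto simp: not_le[symmetric])
  then have "prob {\<omega> \<in> space M. OPT n (\<lambda>i. X i \<omega>) (H \<omega>) K > OPT_unc n (\<lambda>i. X i \<omega>) K}
      \<le> prob (E0 \<union> E1 \<union> E2 \<union> E3)"
    using E0(1) E1(1) E2(1) E3(1) by (intro finite_measure_mono) auto
  also have "\<dots> \<le> prob E0 + prob E1 + prob E2 + prob E3"
    using E0(1) E1(1) E2(1) E3(1)
    by (intro order_trans[OF measure_Un_le] add_mono order_refl) auto
  finally show ?thesis
    using E0(2) E1(2) E2(2) E3(2) by linarith
qed

end
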